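(* Let $b\geq 2$ be an integer and let $A=(a_n)_{n=1}^{\infty}$ be a strictly increasing sequence of positive integers with $\eta:=\limsup_{n\to\infty}\frac{a_{n+1}}{a_n}<+\infty$. If $\eta=1$, then for any $\hat v\in[0,1]$, $$\dim_{\rm H}(\hat{\mathcal V}^{\ast}_{b,A}(\hat v))=\dim_{\rm H}(\hat{\mathcal V}_{b,A}(\hat v))=\left(\frac{1-\hat v}{1+\hat v}\right)^2.$$
   Context: $\|x\|$ denotes the distance from $x\in\mathbb R$ to the nearest integer; $\dim_{\rm H}$ is Hausdorff dimension. For real $\xi$, $$\hat v_{b,A}(\xi):=\sup\Big\{\hat v\ge 0:\ \text{for all sufficiently large integers }N,\ \min_{1\le n\le N}\|b^{a_n}\xi\|<(b^{a_N})^{-\hat v}\Big\}\in[0,+\infty].$$ (The exponent is introduced for irrational $\xi$; for rational $\xi$ the same formula is used.) For $\hat v\in[0,\eta]$, $$\hat{\mathcal V}_{b,A}(\hat v):=\{\xi\in\mathbb R:\hat v_{b,A}(\xi)\ge\hat v\},\qquad \hat{\mathcal V}^{\ast}_{b,A}(\hat v):=\{\xi\in\mathbb R:\hat v_{b,A}(\xi)=\hat v\}.$$ *)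

theory Defs
  imports "HOL-Analysis.Analysis"
begin

section \<open>Hausdorff dimension\<close>

text \<open>
  The weight \<open>|U|\<^sup>s\<close> of a bounded covering set. The usual conventions \<open>|U|\<^sup>0 = 1\<close> for nonempty \<open>U\<close>
  and \<open>|{}|\<^sup>s = 0\<close> for all \<open>s \<ge> 0\<close> need a case distinction, since \<open>0 powr 0 = 0\<close>.
\<close>

definition diam_weight :: "real \<Rightarrow> 'a::metric_space set \<Rightarrow> ennreal" where
  "diam_weight s U =
     (if U = {} then 0 else if s = 0 then 1 else ennreal (diameter U powr s))"

text \<open>
  Boundedness of the covering sets is required explicitly, because the real-valued \<^const>\<open>diameter\<close>
  is unspecified on unbounded sets. The sets of a cover may be empty, so finite covers are included.
\<close>

definition hausdorff_premeasure :: "real \<Rightarrow> real \<Rightarrow> 'a::metric_space set \<Rightarrow> ennreal" where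
  "hausdorff_premeasure s \<delta> E =
     Inf {(\<Sum>i. diam_weight s (U i)) | U :: nat \<Rightarrow> 'a set.
            E \<subseteq> (\<Union>i. U i) \<and> (\<forall>i. bounded (U i) \<and> diameter (U i) \<le> \<delta>)}"

definition hausdorff_measure :: "real \<Rightarrow> 'a::metric_space set \<Rightarrow> ennreal" where
  "hausdorff_measure s E = (SUP \<delta>\<in>{0<..}. hausdorff_premeasure s \<delta> E)"

text \<open>With this definition the empty set has dimension \<open>0\<close>.\<close>

definition hausdorff_dim :: "'a::metric_space set \<Rightarrow> ereal" where
  "hausdorff_dim E = Inf (ereal ` {s. 0 \<le> s \<and> hausdorff_measure s E = 0})"


section \<open>The uniform exponent of approximation\<close>

definition nearest_int_dist :: "real \<Rightarrow> real" where
  "nearest_int_dist x = infdist x \<int>"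

text \<open>
  Sequences are indexed from \<open>1\<close>: the value \<open>a 0\<close> is never used, apart from the irrelevant term \<open>N = 0\<close>
  of the \<^const>\<open>eventually\<close> below.
\<close>

definition uniform_exponent :: "nat \<Rightarrow> (nat \<Rightarrow> nat) \<Rightarrow> real \<Rightarrow> ereal" where
  "uniform_exponent b a \<xi> =
     Sup (ereal ` {v. 0 \<le> v \<and>
       (\<forall>\<^sub>F N in sequentially.
          Min ((\<lambda>n. nearest_int_dist (real b ^ a n * \<xi>)) ` {1..N}) < (real b ^ a N) powr (- v))})"

definition uniform_set :: "nat \<Rightarrow> (nat \<Rightarrow> nat) \<Rightarrow> real \<Rightarrow> real set" where
  "uniform_set b a v = {\<xi>. uniform_exponent b a \<xi> \<ge> ereal v}"

definition uniform_set_exact :: "nat \<Rightarrow> (nat \<Rightarrow> nat) \<Rightarrow> real \<Rightarrow> real set" where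
  "uniform_set_exact b a v = {\<xi>. uniform_exponent b a \<xi> = ereal v}"

end

theory Submission
  imports Defs "HOL-Real_Asymp.Real_Asymp"
begin

text \<open>
  Since \<open>a (n + 1) / a n\<close> tends to \<open>1\<close>, every index is within a factor \<open>1 + \<epsilon>\<close> of a term of the sequence, and
  passing from \<open>n\<close> to a nearby term \<open>m \<ge> n\<close> costs only a factor \<open>b ^ (m - n)\<close> in the distance to the nearest integer.
  Hence the exponent is the one for the sequence of all positive integers.

  Upper bound: let \<open>n 0 < n 1 < \<dots>\<close> be the record times of \<open>\<lambda>n. nearest_int_dist (b ^ n * \<xi>)\<close> for a point whose
  exponent exceeds \<open>w\<close>. Then \<open>\<xi>\<close> lies within about \<open>b\<close> to the power \<open>- n k - w * n (k + 1)\<close> of a \<open>b\<close>-adic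
  rational, and for given record times about \<open>b\<close> to the power \<open>n k - w * (n 1 + \<dots> + n k)\<close> such rationals occur. An
  elementary argument on the ratios of the partial sums shows that for every \<open>s > ((1 - w) / (1 + w))\<^sup>2\<close> the latter
  exponent is infinitely often at most \<open>s * (n k + w * n (k + 1))\<close>.

  Lower bound: take digit sequences that vanish on the blocks from \<open>r ^ k\<close> to \<open>r ^ k * (1 + v) / (1 - v)\<close>, where
  \<open>r = 2 / (1 - v)\<close>, and are otherwise free up to a small proportion of prescribed digits. Reading the free digits as an
  expansion of a number in the unit interval gives a Hoelder map onto that interval, so the measure of the digit set is
  bounded below by Lebesgue measure.
\<close>

section \<open>Hausdorff measure and dimension\<close>

text \<open>The square can be read off the digit construction. Put
  \<open>q = (1 - v) / (1 + v)\<close>. Up to a block start a proportion of about \<open>q\<close>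
  of the positions lies outside the blocks, and the block start is itself \<open>q\<close> times the
  block end. So at the block end, which is the worst scale, only the proportion
  \<open>q\<^sup>2\<close> is left. In the upper bound the same value comes from a discriminant.

  The obstacle in the upper bound is that the record times depend on the point. The covers therefore
  run over all finite chains ending at \<open>N\<close>. Each point offers only infinitely many good
  stages, not all of them; this suffices because level \<open>N\<close> has exponentially small
  weight, so that the levels beyond any \<open>M\<close> still form a cover, of small total weight.
  The supremum in the exponent need not be attained; hence the covers are made for
  \<open>w < v\<close>, and \<open>w\<close> tends to \<open>v\<close>.

  In the lower bound every point of the digit set has exponent exactly \<open>v\<close>. Since the
  exact set is contained in the other one, a lower bound for the former and an upper bound for the
  latter settle both dimensions. For \<open>v = 1\<close> the value is 0 and there is nothing to
  construct.\<close>

lemma diam_weight_empty [simp]: "diam_weight s {} = 0"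
  by (simp add: diam_weight_def)

lemma hausdorff_premeasure_le:
  assumes "E \<subseteq> (\<Union>i. U i)" "\<And>i. bounded (U i)" "\<And>i. diameter (U i) \<le> \<delta>"
  shows "hausdorff_premeasure s \<delta> E \<le> (\<Sum>i. diam_weight s (U i))"
  unfolding hausdorff_premeasure_def using assms by (intro Inf_lower) blast

lemma hausdorff_premeasure_mono:
  "E \<subseteq> F \<Longrightarrow> hausdorff_premeasure s \<delta> E \<le> hausdorff_premeasure s \<delta> F"
  unfolding hausdorff_premeasure_def by (intro Inf_superset_mono) blast

lemma hausdorff_premeasure_le_diam_weight:
  assumes "E \<subseteq> U" "bounded U" "diameter U \<le> \<delta>" "0 \<le> \<delta>"
  shows "hausdorff_premeasure s \<delta> E \<le> diam_weight s U"
proof -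
  define V where "V i = (if i = 0 then U else {})" for i :: nat
  have "hausdorff_premeasure s \<delta> E \<le> (\<Sum>i. diam_weight s (V i))"
    using assms by (intro hausdorff_premeasure_le) (auto simp: V_def diameter_empty)
  also have "\<dots> = (\<Sum>i\<in>{0}. diam_weight s (V i))"
    by (rule suminf_finite) (auto simp: V_def)
  finally show ?thesis by (simp add: V_def)
qed

lemma hausdorff_premeasure_empty [simp]: "0 \<le> \<delta> \<Longrightarrow> hausdorff_premeasure s \<delta> {} = 0"
  using hausdorff_premeasure_le_diam_weight[of "{}" "{}" \<delta> s] by (simp add: diameter_empty)

lemma hausdorff_premeasure_near_optimal_cover:
  assumes "hausdorff_premeasure s \<delta> E < \<infinity>" "0 < e"
  shows "\<exists>U. E \<subseteq> (\<Union>j. U j) \<and> (\<forall>j. bounded (U j) \<and> diameter (U j) \<le> \<delta>) \<and>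
           (\<Sum>j. diam_weight s (U j)) \<le> hausdorff_premeasure s \<delta> E + ennreal e"
proof -
  define c where "c = hausdorff_premeasure s \<delta> E + ennreal e"
  have "hausdorff_premeasure s \<delta> E < c"
  proof (cases "hausdorff_premeasure s \<delta> E")
    case (real r)
    have "ennreal r < ennreal (r + e)"
      using real assms(2) by (intro ennreal_lessI) auto
    then show ?thesis using real assms(2) by (simp add: c_def)
  qed (use assms(1) in simp)
  then show ?thesis
    unfolding c_def[symmetric] unfolding hausdorff_premeasure_def Inf_less_iff
    by (auto intro: less_imp_le)
qed

lemma hausdorff_premeasure_UN_le:
  fixes E :: "nat \<Rightarrow> 'a::metric_space set"
  shows "hausdorff_premeasure s \<delta> (\<Union>i. E i) \<le> (\<Sum>i. hausdorff_premeasure s \<delta> (E i))"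
proof (cases "(\<Sum>i. hausdorff_premeasure s \<delta> (E i)) = \<infinity>")
  case False
  show ?thesis
  proof (rule ennreal_le_epsilon)
    fix e :: real assume e: "0 < e"
    have fin: "hausdorff_premeasure s \<delta> (E i) < \<infinity>" for i
      using False ennreal_suminf_lessD[of "\<lambda>i. hausdorff_premeasure s \<delta> (E i)" \<infinity> i]
      by (simp add: less_top)
    have "\<exists>U. E i \<subseteq> (\<Union>j. U j) \<and> (\<forall>j. bounded (U j) \<and> diameter (U j) \<le> \<delta>) \<and>
            (\<Sum>j. diam_weight s (U j)) \<le> hausdorff_premeasure s \<delta> (E i) + ennreal (e * (1/2) ^ Suc i)" for i
      using hausdorff_premeasure_near_optimal_cover[OF fin[of i], of "e * (1/2) ^ Suc i"] e by simp
    then obtain U where U: "\<And>i. E i \<subseteq> (\<Union>j. U i j)"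
      "\<And>i j. bounded (U i j)" "\<And>i j. diameter (U i j) \<le> \<delta>"
      "\<And>i. (\<Sum>j. diam_weight s (U i j)) \<le> hausdorff_premeasure s \<delta> (E i) + ennreal (e * (1/2) ^ Suc i)"
      by metis
    have "hausdorff_premeasure s \<delta> (\<Union>i. E i)
        \<le> (\<Sum>i. diam_weight s (case prod_decode i of (m, n) \<Rightarrow> U m n))"
    proof (rule hausdorff_premeasure_le)
      show "(\<Union>i. E i) \<subseteq> (\<Union>i. case prod_decode i of (m, n) \<Rightarrow> U m n)"
      proof
        fix x assume "x \<in> (\<Union>i. E i)"
        then obtain m n where "x \<in> U m n" using U(1) by blast
        then have "x \<in> (case prod_decode (prod_encode (m, n)) of (m, n) \<Rightarrow> U m n)" by simp
        then show "x \<in> (\<Union>i. case prod_decode i of (m, n) \<Rightarrow> U m n)"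
          by (rule UN_I[OF UNIV_I])
      qed
    qed (simp_all add: U(2,3) split: prod.split)
    also have "\<dots> = (\<Sum>i. (\<lambda>(m, n). diam_weight s (U m n)) (prod_decode i))"
      by (intro arg_cong[where f = suminf] ext) (auto split: prod.split)
    also have "\<dots> = (\<Sum>i. \<Sum>j. diam_weight s (U i j))"
      by (intro suminf_ennreal_2dimen) auto
    also have "\<dots> \<le> (\<Sum>i. hausdorff_premeasure s \<delta> (E i) + ennreal (e * (1/2) ^ Suc i))"
      by (intro suminf_le U) auto
    also have "\<dots> = (\<Sum>i. hausdorff_premeasure s \<delta> (E i)) + (\<Sum>i. ennreal (e * (1/2) ^ Suc i))"
      by (intro suminf_add[symmetric]) auto
    also have "(\<Sum>i. ennreal (e * (1/2) ^ Suc i)) = ennreal e"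
    proof (rule sums_unique[symmetric])
      have "(\<lambda>i. e * (1/2) ^ Suc i) sums (e * 1)"
        by (intro sums_mult power_half_series)
      then show "(\<lambda>i. ennreal (e * (1/2) ^ Suc i)) sums ennreal e"
        using e by (subst sums_ennreal) auto
    qed
    finally show "hausdorff_premeasure s \<delta> (\<Union>i. E i)
        \<le> (\<Sum>i. hausdorff_premeasure s \<delta> (E i)) + ennreal e" .
  qed
qed auto

lemma hausdorff_premeasure_finite_UN_le:
  assumes "finite I" "0 \<le> \<delta>"
  shows "hausdorff_premeasure s \<delta> (\<Union>i\<in>I. E i) \<le> (\<Sum>i\<in>I. hausdorff_premeasure s \<delta> (E i))"
  using assms(1)
proof induction
  case empty
  show ?case using assms(2) by simp
next
  case (insert x F)
  define G where "G i = (if i = 0 then E x else if i = Suc 0 then (\<Union>i\<in>F. E i) else {})" for i :: nat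
  have "hausdorff_premeasure s \<delta> (\<Union>i\<in>insert x F. E i) \<le> hausdorff_premeasure s \<delta> (\<Union>i. G i)"
    by (intro hausdorff_premeasure_mono)
      (auto simp: G_def split: if_splits intro!: exI[of _ 0] exI[of _ "Suc 0"])
  also have "\<dots> \<le> (\<Sum>i. hausdorff_premeasure s \<delta> (G i))"
    by (rule hausdorff_premeasure_UN_le)
  also have "\<dots> = (\<Sum>i\<in>{0, Suc 0}. hausdorff_premeasure s \<delta> (G i))"
    using assms(2) by (intro suminf_finite) (auto simp: G_def)
  also have "\<dots> = hausdorff_premeasure s \<delta> (E x) + hausdorff_premeasure s \<delta> (\<Union>i\<in>F. E i)"
    by (simp add: G_def)
  also have "\<dots> \<le> hausdorff_premeasure s \<delta> (E x) + (\<Sum>i\<in>F. hausdorff_premeasure s \<delta> (E i))"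
    by (intro add_left_mono insert.IH)
  finally show ?case using insert by simp
qed

lemma hausdorff_measure_eq_0_iff:
  "hausdorff_measure s E = 0 \<longleftrightarrow> (\<forall>\<delta>>0. hausdorff_premeasure s \<delta> E = 0)"
  unfolding hausdorff_measure_def bot_ennreal[symmetric] SUP_bot_conv by auto

lemma hausdorff_null_countable_UN:
  assumes "countable I" "\<And>i. i \<in> I \<Longrightarrow> hausdorff_measure s (E i) = 0"
  shows "hausdorff_measure s (\<Union>i\<in>I. E i) = 0"
proof (cases "I = {}")
  case True
  then show ?thesis by (simp add: hausdorff_measure_eq_0_iff)
next
  case False
  show ?thesis
    unfolding hausdorff_measure_eq_0_iff
  proof safe
    fix \<delta> :: real assume \<delta>: "0 < \<delta>"
    have "(\<Union>i\<in>I. E i) = (\<Union>n. E (from_nat_into I n))"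
      using assms(1) False by (metis image_image range_from_nat_into)
    then have "hausdorff_premeasure s \<delta> (\<Union>i\<in>I. E i)
        \<le> (\<Sum>n. hausdorff_premeasure s \<delta> (E (from_nat_into I n)))"
      by (simp add: hausdorff_premeasure_UN_le)
    also have "\<dots> = 0"
      using assms(2) False \<delta> by (simp add: hausdorff_measure_eq_0_iff from_nat_into)
    finally show "hausdorff_premeasure s \<delta> (\<Union>i\<in>I. E i) = 0" by simp
  qed
qed

lemma hausdorff_null_subset:
  "hausdorff_measure s F = 0 \<Longrightarrow> E \<subseteq> F \<Longrightarrow> hausdorff_measure s E = 0"
  unfolding hausdorff_measure_eq_0_iff
  by (metis hausdorff_premeasure_mono le_zero_eq)

lemma hausdorff_null_countable:
  assumes "countable A" "0 < s"
  shows "hausdorff_measure s A = 0"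
proof -
  have "hausdorff_measure s {x} = 0" for x :: 'a
    unfolding hausdorff_measure_eq_0_iff
    using hausdorff_premeasure_le_diam_weight[of "{x}" "{x}" _ s] assms(2)
    by (auto simp: diam_weight_def)
  then have "hausdorff_measure s (\<Union>x\<in>A. {x}) = 0"
    using assms(1) by (intro hausdorff_null_countable_UN) auto
  then show ?thesis by simp
qed

lemma hausdorff_dim_le:
  assumes "\<And>s. t < s \<Longrightarrow> hausdorff_measure s E = 0" "0 \<le> t"
  shows "hausdorff_dim E \<le> ereal t"
proof (rule ereal_le_epsilon2)
  fix e :: real assume "0 < e"
  then have "ereal (t + e) \<in> ereal ` {s. 0 \<le> s \<and> hausdorff_measure s E = 0}"
    using assms by auto
  then show "hausdorff_dim E \<le> ereal t + ereal e"
    unfolding hausdorff_dim_def by (simp add: Inf_lower)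
qed

lemma hausdorff_dim_ge:
  assumes "\<And>s. 0 \<le> s \<Longrightarrow> s < t \<Longrightarrow> hausdorff_measure s E \<noteq> 0"
  shows "ereal t \<le> hausdorff_dim E"
  unfolding hausdorff_dim_def using assms by (intro Inf_greatest) (auto simp: not_less[symmetric])

lemma hausdorff_dim_mono: "E \<subseteq> F \<Longrightarrow> hausdorff_dim E \<le> hausdorff_dim F"
  unfolding hausdorff_dim_def
  by (intro Inf_superset_mono image_mono) (auto intro: hausdorff_null_subset)

text \<open>A cover of \<open>K\<close> pulls back along \<open>g\<close> to a cover of the unit
  interval, and the preimage of a set of diameter \<open>x\<close> lies in an interval of length
  \<open>2 * C * x powr s\<close>. Lebesgue measure then forces every cover sum to be at least
  \<open>1 / (2 * C)\<close>. Enclosing the preimages \<open>V i\<close> in intervals avoids any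
  measurability of \<open>g\<close>.\<close>

lemma hausdorff_measure_pos_if_inverse_holder:
  fixes g :: "real \<Rightarrow> 'a::metric_space"
  assumes "0 \<le> s" "0 < C" "g ` {0..<1} \<subseteq> K"
    and hol: "\<And>t t'. t \<in> {0..<1} \<Longrightarrow> t' \<in> {0..<1} \<Longrightarrow> t \<noteq> t' \<Longrightarrow>
                \<bar>t - t'\<bar> \<le> C * dist (g t) (g t') powr s \<and> g t \<noteq> g t'"
  shows "hausdorff_measure s K \<noteq> 0"
proof -
  have "ennreal (1 / (2 * C)) \<le> hausdorff_premeasure s 1 K"
    unfolding hausdorff_premeasure_def
  proof (rule Inf_greatest, safe)
    fix U :: "nat \<Rightarrow> 'a set"
    assume KU: "K \<subseteq> (\<Union>i. U i)" and U: "\<forall>i. bounded (U i) \<and> diameter (U i) \<le> 1"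
    define V where "V i = {t \<in> {0..<1}. g t \<in> U i}" for i
    have "\<exists>I. V i \<subseteq> I \<and> I \<in> sets lborel \<and> emeasure lborel I \<le> ennreal (2 * C) * diam_weight s (U i)" for i
    proof (cases "V i = {}")
      case True
      then show ?thesis by (intro exI[of _ "{}"]) auto
    next
      case False
      then obtain t where t: "t \<in> V i" by auto
      \<comment> \<open>The case distinction follows \<open>diam_weight\<close>: for
        \<open>s = 0\<close> a nonempty set weighs 1 even if its diameter is 0.\<close>
      define \<rho> where "\<rho> = C * (if s = 0 then 1 else diameter (U i) powr s)"
      have "\<rho> \<ge> 0" using assms(2) by (simp add: \<rho>_def)
      have "V i \<subseteq> {t - \<rho>..t + \<rho>}"
      proof
        fix t' assume t': "t' \<in> V i"
        show "t' \<in> {t - \<rho>..t + \<rho>}"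
        proof (cases "t = t'")
          case True
          then show ?thesis using \<open>\<rho> \<ge> 0\<close> by auto
        next
          case False
          have h: "\<bar>t - t'\<bar> \<le> C * dist (g t) (g t') powr s" "g t \<noteq> g t'"
            using hol[OF _ _ False] t t' by (auto simp: V_def)
          have "dist (g t) (g t') \<le> diameter (U i)"
            using t t' U by (intro diameter_bounded_bound) (auto simp: V_def)
          then have "dist (g t) (g t') powr s \<le> (if s = 0 then 1 else diameter (U i) powr s)"
            using assms(1) by (auto intro!: powr_mono2)
          then have "\<bar>t - t'\<bar> \<le> \<rho>"
            unfolding \<rho>_def using h(1) assms(2) by (meson less_imp_le mult_left_mono order_trans)
          then show ?thesis by auto
        qed
      qed
      moreover have "emeasure lborel {t - \<rho>..t + \<rho>} = ennreal (2 * C) * diam_weight s (U i)"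
      proof -
        have "U i \<noteq> {}" using t by (auto simp: V_def)
        then have "diam_weight s (U i) = ennreal (if s = 0 then 1 else diameter (U i) powr s)"
          by (simp add: diam_weight_def)
        then show ?thesis
          using \<open>\<rho> \<ge> 0\<close> assms(2) by (simp add: \<rho>_def ennreal_mult[symmetric] mult.assoc)
      qed
      ultimately show ?thesis by (intro exI[of _ "{t - \<rho>..t + \<rho>}"]) auto
    qed
    then obtain I where I: "\<And>i. V i \<subseteq> I i" "\<And>i. I i \<in> sets lborel"
      "\<And>i. emeasure lborel (I i) \<le> ennreal (2 * C) * diam_weight s (U i)"
      by metis
    have "{0..<1} \<subseteq> (\<Union>i. V i)"
      using subset_trans[OF assms(3) KU] by (force simp: V_def image_subset_iff)
    then have "{0..<1::real} \<subseteq> (\<Union>i. I i)" using I(1) by blast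
    then have "emeasure lborel {0..<1::real} \<le> emeasure lborel (\<Union>i. I i)"
      using I(2) by (intro emeasure_mono) auto
    also have "\<dots> \<le> (\<Sum>i. emeasure lborel (I i))"
      using I(2) by (intro emeasure_subadditive_countably) auto
    also have "\<dots> \<le> (\<Sum>i. ennreal (2 * C) * diam_weight s (U i))"
      by (intro suminf_le I) auto
    also have "\<dots> = ennreal (2 * C) * (\<Sum>i. diam_weight s (U i))" by simp
    finally have *: "1 \<le> ennreal (2 * C) * (\<Sum>i. diam_weight s (U i))" by simp
    have "ennreal (1 / (2 * C)) * 1 \<le> ennreal (1 / (2 * C)) * (ennreal (2 * C) * (\<Sum>i. diam_weight s (U i)))"
      by (intro mult_left_mono *) auto
    also have "\<dots> = (\<Sum>i. diam_weight s (U i))"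
      using assms(2) by (simp add: mult.assoc[symmetric] ennreal_mult[symmetric])
    finally show "ennreal (1 / (2 * C)) \<le> (\<Sum>i. diam_weight s (U i))" by simp
  qed
  moreover have "ennreal (1 / (2 * C)) > 0" using assms(2) by simp
  ultimately have "hausdorff_premeasure s 1 K \<noteq> 0" by auto
  then show ?thesis
    unfolding hausdorff_measure_eq_0_iff using zero_less_one by blast
qed

section \<open>Distance to the nearest integer and reduction to all integers\<close>

lemma nearest_int_dist_le: "nearest_int_dist x \<le> \<bar>x - of_int m\<bar>"
  unfolding nearest_int_dist_def dist_real_def[symmetric] by (intro infdist_le) auto

lemma nearest_int_dist_attained: "\<exists>m. nearest_int_dist x = \<bar>x - of_int m\<bar>"
proof -
  obtain y where "y \<in> \<int>" "infdist x \<int> = dist x y"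
    using infdist_attains_inf[of "\<int> :: real set" x] closed_Ints Ints_0 by blast
  then show ?thesis
    by (auto simp: nearest_int_dist_def dist_real_def elim!: Ints_cases)
qed

lemma nearest_int_dist_nonneg [simp]: "0 \<le> nearest_int_dist x"
  by (simp add: nearest_int_dist_def infdist_nonneg)

lemma nearest_int_dist_le_half: "nearest_int_dist x \<le> 1 / 2"
  using nearest_int_dist_le[of x "round x"] of_int_round_abs_le[of x] by linarith

lemma nearest_int_dist_geI: "(\<And>m. c \<le> \<bar>x - of_int m\<bar>) \<Longrightarrow> c \<le> nearest_int_dist x"
  using nearest_int_dist_attained[of x] by metis

lemma nearest_int_dist_mult_le:
  "nearest_int_dist (real k * x) \<le> real k * nearest_int_dist x"
proof -
  obtain m where m: "nearest_int_dist x = \<bar>x - of_int m\<bar>"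
    using nearest_int_dist_attained by blast
  have "nearest_int_dist (real k * x) \<le> \<bar>real k * x - of_int (int k * m)\<bar>"
    by (rule nearest_int_dist_le)
  also have "real k * x - of_int (int k * m) = real k * (x - of_int m)"
    by (simp add: algebra_simps)
  finally show ?thesis by (simp add: m abs_mult)
qed

text \<open>Below 1/2, no integer is closer to \<open>k * x\<close> than \<open>k\<close> times the
  integer nearest to \<open>x\<close>. Hence distances grow exactly by powers of \<open>b\<close>
  until they reach about 1/2, which is what spaces the record times.\<close>

lemma nearest_int_dist_mult_eq:
  assumes "real k * nearest_int_dist x < 1 / 2"
  shows "nearest_int_dist (real k * x) = real k * nearest_int_dist x"
proof (rule antisym[OF nearest_int_dist_mult_le])
  obtain m where m: "nearest_int_dist x = \<bar>x - of_int m\<bar>"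
    using nearest_int_dist_attained by blast
  have "real k * x - of_int (int k * m) = real k * (x - of_int m)"
    by (simp add: algebra_simps)
  then have eq: "real k * nearest_int_dist x = \<bar>real k * x - of_int (int k * m)\<bar>"
    by (simp only: m abs_mult abs_of_nat)
  show "real k * nearest_int_dist x \<le> nearest_int_dist (real k * x)"
  proof (rule nearest_int_dist_geI)
    fix j :: int
    show "real k * nearest_int_dist x \<le> \<bar>real k * x - of_int j\<bar>"
    proof (cases "j = int k * m")
      case False
      then have "1 \<le> \<bar>j - int k * m\<bar>" by linarith
      then have "1 \<le> \<bar>real_of_int j - of_int (int k * m)\<bar>"
        by (metis of_int_1_le_iff of_int_abs of_int_diff)
      then show ?thesis using assms unfolding eq by linarith
    qed (simp add: eq)
  qed
qed

section \<open>Uniform approximability as a predicate\<close>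

definition uniformly_approx :: "nat \<Rightarrow> (nat \<Rightarrow> nat) \<Rightarrow> real \<Rightarrow> real \<Rightarrow> bool" where
  "uniformly_approx b a v \<xi> \<longleftrightarrow>
     (\<forall>\<^sub>F N in sequentially. \<exists>n\<in>{1..N}. nearest_int_dist (real b ^ a n * \<xi>) < real b powr (- v * real (a N)))"

lemma uniform_exponent_eq_Sup:
  assumes "b > 0"
  shows "uniform_exponent b a \<xi> = Sup (ereal ` {v. 0 \<le> v \<and> uniformly_approx b a v \<xi>})"
proof -
  have "(\<forall>\<^sub>F N in sequentially.
          Min ((\<lambda>n. nearest_int_dist (real b ^ a n * \<xi>)) ` {1..N}) < (real b ^ a N) powr (- v))
      \<longleftrightarrow> uniformly_approx b a v \<xi>" for v
    unfolding uniformly_approx_def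
  proof (rule eventually_cong[OF eventually_ge_at_top[of 1]])
    fix N :: nat assume "1 \<le> N"
    then show "Min ((\<lambda>n. nearest_int_dist (real b ^ a n * \<xi>)) ` {1..N}) < (real b ^ a N) powr (- v)
      \<longleftrightarrow> (\<exists>n\<in>{1..N}. nearest_int_dist (real b ^ a n * \<xi>) < real b powr (- v * real (a N)))"
      using assms by (subst Min_less_iff) (auto simp: powr_realpow[symmetric] powr_powr mult.commute)
  qed
  then show ?thesis unfolding uniform_exponent_def by simp
qed

text \<open>Distances are at most 1/2, below \<open>b powr 0\<close>. So 0 always belongs to the set
  whose supremum is the exponent, which is therefore never minus infinity.\<close>

lemma uniformly_approx_0: "b > 0 \<Longrightarrow> uniformly_approx b a 0 \<xi>"
  unfolding uniformly_approx_def
  by (rule eventually_mono[OF eventually_ge_at_top[of 1]])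
    (auto intro!: bexI[of _ 1] le_less_trans[OF nearest_int_dist_le_half])

lemma uniform_exponent_geI:
  assumes "b > 0" "\<And>u. 0 \<le> u \<Longrightarrow> u < v \<Longrightarrow> uniformly_approx b a u \<xi>" "0 \<le> v"
  shows "ereal v \<le> uniform_exponent b a \<xi>"
proof (cases "v = 0")
  case True
  then show ?thesis
    unfolding uniform_exponent_eq_Sup[OF assms(1)] using uniformly_approx_0[OF assms(1)]
    by (intro Sup_upper) auto
next
  case False
  with assms(3) have v: "0 < v" by simp
  have "ereal u \<le> uniform_exponent b a \<xi>" if "u < v" for u
  proof -
    have "ereal (max u 0) \<in> ereal ` {v. 0 \<le> v \<and> uniformly_approx b a v \<xi>}"
      using assms(2)[of "max u 0"] that v by (intro imageI) auto
    then have "ereal (max u 0) \<le> uniform_exponent b a \<xi>"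
      unfolding uniform_exponent_eq_Sup[OF assms(1)] by (rule Sup_upper)
    then show ?thesis by (metis ereal_less_eq(3) max.cobounded1 order_trans)
  qed
  note lower = this
  show ?thesis
  proof (cases "uniform_exponent b a \<xi>")
    case (real x)
    then show ?thesis using lower by (auto intro: dense_le)
  next
    case MInf
    then show ?thesis using lower[of "v - 1"] by simp
  qed simp
qed

lemma uniform_exponent_leI:
  assumes "b > 0" "\<And>u. 0 \<le> u \<Longrightarrow> v < u \<Longrightarrow> \<not> uniformly_approx b a u \<xi>"
  shows "uniform_exponent b a \<xi> \<le> ereal v"
  unfolding uniform_exponent_eq_Sup[OF assms(1)]
proof (rule Sup_least, safe)
  fix u :: real assume "0 \<le> u" "uniformly_approx b a u \<xi>"
  then show "ereal u \<le> ereal v" using assms(2)[of u] by (cases "v < u") auto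
qed

lemma uniformly_approx_if_less_exponent:
  assumes "b > 1" "ereal v \<le> uniform_exponent b a \<xi>" "w < v"
  shows "uniformly_approx b a w \<xi>"
proof -
  have "ereal w < Sup (ereal ` {v. 0 \<le> v \<and> uniformly_approx b a v \<xi>})"
    using assms uniform_exponent_eq_Sup[of b a \<xi>] by (metis ereal_less(2) ereal_less_eq(3)
        less_ereal.simps(1) less_le_trans less_trans zero_less_one)
  then obtain u where u: "w < u" "uniformly_approx b a u \<xi>"
    by (auto simp: less_Sup_iff)
  show ?thesis
    using u(2) unfolding uniformly_approx_def
  proof (rule eventually_mono)
    fix N assume "\<exists>n\<in>{1..N}. nearest_int_dist (real b ^ a n * \<xi>) < real b powr (- u * real (a N))"
    moreover have "real b powr (- u * real (a N)) \<le> real b powr (- w * real (a N))"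
      using assms(1) u(1) by (intro powr_mono) (auto intro: mult_right_mono)
    ultimately show "\<exists>n\<in>{1..N}. nearest_int_dist (real b ^ a n * \<xi>) < real b powr (- w * real (a N))"
      by (meson less_le_trans)
  qed
qed

text \<open>An arbitrarily small loss \<open>u' < u\<close> is invisible to the supremum. Both
  directions of the comparison with all integers have this form.\<close>

lemma uniform_exponent_mono:
  assumes "b > 1"
    and "\<And>u u'. uniformly_approx b a u \<xi> \<Longrightarrow> 0 \<le> u' \<Longrightarrow> u' < u \<Longrightarrow> uniformly_approx b a' u' \<xi>"
  shows "uniform_exponent b a \<xi> \<le> uniform_exponent b a' \<xi>"
  unfolding uniform_exponent_eq_Sup[of b a, OF less_trans[OF zero_less_one assms(1)]]
proof (rule Sup_least, safe)
  fix u :: real assume "0 \<le> u" "uniformly_approx b a u \<xi>"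
  then show "ereal u \<le> uniform_exponent b a' \<xi>"
    using assms by (intro uniform_exponent_geI) auto
qed

section \<open>Comparison of a slowly growing sequence with all positive integers\<close>

locale slowly_growing_seq =
  fixes a :: "nat \<Rightarrow> nat"
  assumes strict: "strict_mono_on {1..} a"
    and pos: "\<And>n. n \<ge> 1 \<Longrightarrow> a n > 0"
    and ratio: "limsup (\<lambda>n. ereal (real (a (Suc n)) / real (a n))) \<le> 1"
begin

lemma less: "1 \<le> m \<Longrightarrow> m < n \<Longrightarrow> a m < a n"
  using strict by (auto simp: strict_mono_on_def)

lemma mono: "1 \<le> m \<Longrightarrow> m \<le> n \<Longrightarrow> a m \<le> a n"
  using less[of m n] by (cases "m = n") auto

lemma ge_index: "1 \<le> n \<Longrightarrow> n \<le> a n"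
proof (induction n rule: dec_induct)
  case base
  show ?case using pos[of 1] by simp
next
  case (step n)
  then show ?case using less[of n "Suc n"] by simp
qed

lemma eventually_Suc_le:
  assumes "0 < e"
  obtains N where "1 \<le> N" "\<And>n. N \<le> n \<Longrightarrow> real (a (Suc n)) \<le> (1 + e) * real (a n)"
proof -
  have "limsup (\<lambda>n. ereal (real (a (Suc n)) / real (a n))) < ereal (1 + e)"
    using ratio assms by (simp add: le_less_trans one_ereal_def)
  then have "\<forall>\<^sub>F n in sequentially. ereal (real (a (Suc n)) / real (a n)) < ereal (1 + e)"
    by (rule Limsup_lessD)
  then obtain N where N: "\<And>n. N \<le> n \<Longrightarrow> real (a (Suc n)) / real (a n) < 1 + e"
    by (auto simp: eventually_sequentially)
  show ?thesis
  proof
    fix n assume "max 1 N \<le> n"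
    then show "real (a (Suc n)) \<le> (1 + e) * real (a n)"
      using N[of n] pos[of n] by (simp add: field_simps)
  qed auto
qed

lemma largest_le:
  assumes "a 1 \<le> M"
  obtains N where "1 \<le> N" "a N \<le> M" "M < a (Suc N)"
proof -
  define N where "N = Max {n. 1 \<le> n \<and> a n \<le> M}"
  have fin: "finite {n. 1 \<le> n \<and> a n \<le> M}"
    by (rule finite_subset[of _ "{..M}"]) (use ge_index in \<open>auto intro: order_trans\<close>)
  have "N \<in> {n. 1 \<le> n \<and> a n \<le> M}"
    unfolding N_def using fin assms by (intro Max_in) auto
  moreover have "M < a (Suc N)"
  proof (rule ccontr)
    assume "\<not> M < a (Suc N)"
    then have "Suc N \<le> N" unfolding N_def[symmetric]
      using Max_ge[OF fin, of "Suc N"] by (simp add: N_def)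
    then show False by simp
  qed
  ultimately show ?thesis using that by auto
qed

lemma uniformly_approx_id:
  assumes "b > 1" "uniformly_approx b a u \<xi>" "0 \<le> u'" "u' < u"
  shows "uniformly_approx b (\<lambda>n. n) u' \<xi>"
proof -
  \<comment> \<open>Replacing an arbitrary \<open>M\<close> by the last \<open>a N \<le> M\<close>
    costs a factor \<open>1 + e\<close>; the choice gives
    \<open>u' * (1 + e) \<le> u\<close>.\<close>
  define e where "e = (u - u') / (u' + 1)"
  have e: "0 < e" using assms by (simp add: e_def)
  have ue: "u' * (1 + e) \<le> u"
    using assms by (simp add: e_def field_simps)
  obtain N1 where N1: "1 \<le> N1" "\<And>n. N1 \<le> n \<Longrightarrow> real (a (Suc n)) \<le> (1 + e) * real (a n)"
    using eventually_Suc_le[OF e] by blast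
  obtain N0 where N0: "\<And>N. N0 \<le> N \<Longrightarrow>
      \<exists>n\<in>{1..N}. nearest_int_dist (real b ^ a n * \<xi>) < real b powr (- u * real (a N))"
    using assms(2) unfolding uniformly_approx_def eventually_sequentially by blast
  show ?thesis
    unfolding uniformly_approx_def eventually_sequentially
  proof (intro exI allI impI)
    fix M assume M: "a (max N0 N1) \<le> M"
    have "a 1 \<le> a (max N0 N1)" using N1 by (intro mono) auto
    then obtain N where N: "1 \<le> N" "a N \<le> M" "M < a (Suc N)"
      using largest_le[of M] M by auto
    have "max N0 N1 < Suc N"
    proof (rule ccontr)
      assume "\<not> max N0 N1 < Suc N"
      then have "a (Suc N) \<le> a (max N0 N1)" by (intro mono) auto
      then show False using M N by simp
    qed
    then have NN: "N0 \<le> N" "N1 \<le> N" by auto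
    obtain n where n: "n \<in> {1..N}" "nearest_int_dist (real b ^ a n * \<xi>) < real b powr (- u * real (a N))"
      using N0[OF NN(1)] by blast
    have "u' * real M \<le> u' * ((1 + e) * real (a N))"
      using N1(2)[OF NN(2)] N(3) assms(3) by (intro mult_left_mono) auto
    also have "\<dots> \<le> u * real (a N)"
      using ue by (simp add: mult.assoc[symmetric] mult_right_mono)
    finally have "real b powr (- u * real (a N)) \<le> real b powr (- u' * real M)"
      using assms(1) by (intro powr_mono) auto
    moreover have "a n \<in> {1..M}"
      using n(1) N(2) mono[of n N] pos[of n] by auto
    ultimately show "\<exists>n\<in>{1..M}. nearest_int_dist (real b ^ n * \<xi>) < real b powr (- u' * real M)"
      using n(2) less_le_trans by blast
  qed
qed

text \<open>Once all ratios are at most \<open>1 + e\<close>, the next term is close;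
  \<open>C\<close> takes care of the finitely many earlier \<open>n\<close>.\<close>

lemma exists_close_above:
  assumes "0 < e"
  obtains C where "\<And>n. \<exists>j\<ge>1. n \<le> a j \<and> real (a j) \<le> max (real C) ((1 + e) * real n)"
proof -
  obtain J where J: "1 \<le> J" "\<And>n. J \<le> n \<Longrightarrow> real (a (Suc n)) \<le> (1 + e) * real (a n)"
    using eventually_Suc_le[OF assms] by blast
  show ?thesis
  proof
    fix n
    show "\<exists>j\<ge>1. n \<le> a j \<and> real (a j) \<le> max (real (a J)) ((1 + e) * real n)"
    proof (cases "n \<le> a J")
      case True
      then show ?thesis using J by (intro exI[of _ J]) auto
    next
      case False
      have "a 1 \<le> n" using False mono[of 1 J] J(1) by auto
      then obtain N where N: "1 \<le> N" "a N \<le> n" "n < a (Suc N)"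
        using largest_le by blast
      have "J < Suc N"
        using False N mono[of "Suc N" J] by (metis One_nat_def Suc_le_mono le0 less_le_not_le not_less order_trans)
      then have "real (a (Suc N)) \<le> (1 + e) * real (a N)" using J(2)[of N] by auto
      also have "\<dots> \<le> (1 + e) * real n" using N assms by (intro mult_left_mono) auto
      finally show ?thesis using N by (intro exI[of _ "Suc N"]) auto
    qed
  qed
qed

text \<open>The index \<open>n\<close> supplied by the hypothesis has to be moved up to a term
  \<open>a j\<close> that still satisfies \<open>j \<le> N\<close>. The hypothesis is therefore
  applied at \<open>M\<close>, about \<open>a N / (1 + e)\<close>, which leaves room for the
  move.\<close>

lemma uniformly_approx_if_id:
  assumes "b > 1" "uniformly_approx b (\<lambda>n. n) u \<xi>" "0 \<le> u'" "u' < u"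
  shows "uniformly_approx b a u' \<xi>"
proof -
  \<comment> \<open>The loss \<open>e\<close> is paid twice: in \<open>u' * (1 + e)\<close> for
    using \<open>M\<close> in place of \<open>a N\<close>, and in \<open>u - e\<close> for the
    factor \<open>b ^ (a j - n)\<close>.\<close>
  define e where "e = (u - u') / (2 * (u' + 2))"
  have e: "0 < e" using assms by (simp add: e_def)
  have ue: "u' * (1 + e) < u - e"
  proof -
    have "e * (u' + 1) < e * (2 * (u' + 2))" using e assms(3) by (intro mult_strict_left_mono) auto
    also have "\<dots> = u - u'" using assms(3) by (simp add: e_def)
    finally show ?thesis by (simp add: algebra_simps)
  qed
  obtain C where C: "\<And>n. \<exists>j\<ge>1. n \<le> a j \<and> real (a j) \<le> max (real C) ((1 + e) * real n)"
    using exists_close_above[OF e] by blast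
  obtain N0 where N0: "\<And>N. N0 \<le> N \<Longrightarrow>
      \<exists>n\<in>{1..N}. nearest_int_dist (real b ^ n * \<xi>) < real b powr (- u * real N)"
    using assms(2) unfolding uniformly_approx_def eventually_sequentially by blast
  define \<gamma> where "\<gamma> = (u - e) - u' * (1 + e)"
  have \<gamma>: "0 < \<gamma>" using ue by (simp add: \<gamma>_def)
  \<comment> \<open>The first entry gives \<open>j \<le> N\<close>, the second
    \<open>N0 \<le> M\<close>; the third lets the slack \<open>\<gamma>\<close> absorb the rounding
    of \<open>M\<close> and the constant \<open>C\<close>.\<close>
  define K where "K = nat \<lceil>max (real C) (max ((1 + e) * (real N0 + 1)) ((1 + e) * (u + real C) / \<gamma>))\<rceil> + 1"
  show ?thesis
    unfolding uniformly_approx_def eventually_sequentially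
  proof (intro exI allI impI)
    fix N assume "K \<le> N"
    then have "1 \<le> N" by (simp add: K_def)
    have "K \<le> a N" using \<open>K \<le> N\<close> ge_index[OF \<open>1 \<le> N\<close>] by simp
    then have "max (real C) (max ((1 + e) * (real N0 + 1)) ((1 + e) * (u + real C) / \<gamma>)) \<le> real (a N)"
      unfolding K_def by linarith
    then have big: "real C \<le> a N" "(1 + e) * (real N0 + 1) \<le> a N" "(1 + e) * (u + real C) / \<gamma> \<le> a N"
      by auto
    define M where "M = nat \<lfloor>real (a N) / (1 + e)\<rfloor>"
    have M: "real M \<le> real (a N) / (1 + e)" "real (a N) / (1 + e) - 1 < real M"
      unfolding M_def using e by (simp_all add: of_nat_floor)
    have "real N0 + 1 \<le> real (a N) / (1 + e)" using big(2) e by (simp add: field_simps)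
    then have "N0 \<le> M" using M(2) by linarith
    then obtain n where n: "n \<in> {1..M}" "nearest_int_dist (real b ^ n * \<xi>) < real b powr (- u * real M)"
      using N0 by blast
    obtain j where j: "j \<ge> 1" "n \<le> a j" "real (a j) \<le> max (real C) ((1 + e) * real n)"
      using C by blast
    have "(1 + e) * real n \<le> (1 + e) * real M" using n e by (intro mult_left_mono) auto
    also have "\<dots> \<le> real (a N)" using M(1) e by (simp add: field_simps)
    finally have "real (a j) \<le> real (a N)" using j(3) big(1) by linarith
    then have jN: "j \<le> N"
      using less[of N j] \<open>1 \<le> N\<close> by (meson not_le of_nat_le_iff)
    have "nearest_int_dist (real b ^ a j * \<xi>) = nearest_int_dist (real (b ^ (a j - n)) * (real b ^ n * \<xi>))"
      using j(2) by (simp add: mult.assoc[symmetric] power_add[symmetric])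
    also have "\<dots> \<le> real (b ^ (a j - n)) * nearest_int_dist (real b ^ n * \<xi>)"
      by (rule nearest_int_dist_mult_le)
    also have "\<dots> < real (b ^ (a j - n)) * real b powr (- u * real M)"
      using assms(1) n(2) by (intro mult_strict_left_mono) auto
    also have "\<dots> = real b powr (real (a j - n) - u * real M)"
      using assms(1) by (simp add: powr_realpow[symmetric] powr_add[symmetric])
    also have "\<dots> \<le> real b powr (- u' * real (a N))"
    proof (rule powr_mono)
      have "real (a j - n) \<le> max (real C) (e * real n)"
        using j(2,3) by (auto simp: of_nat_diff algebra_simps max_def split: if_splits)
      also have "\<dots> \<le> real C + e * real M"
        using n(1) e by (auto intro!: add_increasing mult_left_mono)
      finally have 1: "real (a j - n) - u * real M \<le> real C - (u - e) * real M"
        by (simp add: algebra_simps)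
      have "u - e > 0" using ue assms(3) e by (smt (verit) mult_nonneg_nonneg)
      then have "(u - e) * (real (a N) / (1 + e) - 1) \<le> (u - e) * real M"
        using M(2) by (intro mult_left_mono) auto
      moreover have "(u - e) * (real (a N) / (1 + e) - 1) - real C \<ge> u' * real (a N)"
      proof -
        have "(1 + e) * (u + real C) \<le> \<gamma> * real (a N)"
          using big(3) \<gamma> by (simp add: field_simps)
        then have "(u + real C) \<le> \<gamma> * real (a N) / (1 + e)"
          using e by (simp add: field_simps)
        also have "\<dots> = (u - e) * (real (a N) / (1 + e)) - u' * real (a N)"
          using e by (simp add: \<gamma>_def field_simps)
        finally show ?thesis using e by (simp add: algebra_simps)
      qed
      ultimately show "real (a j - n) - u * real M \<le> - u' * real (a N)" using 1 by linarith
    qed (use assms(1) in simp)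
    finally show "\<exists>n\<in>{1..N}. nearest_int_dist (real b ^ a n * \<xi>) < real b powr (- u' * real (a N))"
      using j(1) jN by auto
  qed
qed

lemma uniform_exponent_eq_id:
  assumes "b > 1"
  shows "uniform_exponent b a \<xi> = uniform_exponent b (\<lambda>n. n) \<xi>"
  using assms uniformly_approx_id uniformly_approx_if_id
  by (intro antisym uniform_exponent_mono) auto

end

section \<open>Upper bound\<close>

text \<open>
  The \<open>n j\<close> are the successive record times of \<open>\<lambda>n. nearest_int_dist (b ^ n * \<xi>)\<close>. The distance is multiplied
  by \<open>b\<close> at each step as long as it stays below \<open>1/2\<close>, so no new record occurs before it has grown
  to about \<open>1/2\<close>; this gives the middle inequality.
\<close>

lemma record_sequence:
  assumes b: "b \<ge> 2" and w: "0 < w" "w < 1"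
    and approx: "uniformly_approx b (\<lambda>n. n) w \<xi>"
    and nz: "\<And>n. nearest_int_dist (real b ^ n * \<xi>) \<noteq> 0"
  obtains n :: "nat \<Rightarrow> nat" where "\<And>j. n j < n (Suc j)"
    "\<And>j. real (n j) \<le> (1 - w) * real (n (Suc j)) + 2"
    "\<And>j. nearest_int_dist (real b ^ n j * \<xi>) \<le> real b powr (1 - w * real (n (Suc j)))"
proof -
  define d where "d n = nearest_int_dist (real b ^ n * \<xi>)" for n
  have dpos: "0 < d n" for n
    using nz[of n] nearest_int_dist_nonneg[of "real b ^ n * \<xi>"] unfolding d_def by linarith
  obtain N0 where N0: "1 \<le> N0" "\<And>N. N0 \<le> N \<Longrightarrow> \<exists>n\<in>{1..N}. d n < real b powr (- w * real N)"
  proof -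
    obtain N1 where "\<And>N. N1 \<le> N \<Longrightarrow> \<exists>n\<in>{1..N}. d n < real b powr (- w * real N)"
      using approx unfolding uniformly_approx_def eventually_sequentially d_def by blast
    then show ?thesis using that[of "max 1 N1"] by auto
  qed
  \<comment> \<open>Minimality over all of \<open>{1..N0}\<close> is built in, so that the next
    record time exceeds \<open>N0\<close> and the hypothesis applies just before it.\<close>
  define P where "P n \<longleftrightarrow> 1 \<le> n \<and> (\<forall>i\<in>{1..max n N0}. d n \<le> d i)" for n
  define Q where "Q n m \<longleftrightarrow> n < m \<and> real n \<le> (1 - w) * real m + 2 \<and> d n \<le> real b powr (1 - w * real m)" for n m
  have "Min (d ` {1..N0}) \<in> d ` {1..N0}"
    using N0(1) by (intro Min_in) auto
  then obtain n0 where n0: "n0 \<in> {1..N0}" "Min (d ` {1..N0}) = d n0" by (rule imageE)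
  have start: "P n0"
    unfolding P_def using n0(1) n0(2)[symmetric] by (auto simp: max_def)
  have step: "\<exists>m. P m \<and> Q n m" if "P n" for n
  proof -
    have "(\<lambda>N. real b powr (- w * real N)) \<longlonglongrightarrow> 0"
    proof -
      have "(\<lambda>N. (real b powr - w) ^ N) \<longlonglongrightarrow> 0"
        using b w by (intro LIMSEQ_power_zero) (auto simp: powr_less_one)
      moreover have "real b powr (- w * real N) = (real b powr - w) ^ N" for N
        using b by (simp add: powr_realpow[symmetric] powr_powr)
      ultimately show ?thesis by simp
    qed
    then have "\<forall>\<^sub>F N in sequentially. real b powr (- w * real N) < d n"
      using dpos by (rule order_tendstoD(2))
    then obtain N where N: "N0 \<le> N" "real b powr (- w * real N) < d n"
      using eventually_ge_at_top[of N0] by (metis (mono_tags, lifting) eventually_conj eventually_happens' sequentially_bot)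
    obtain m' where "m' \<in> {1..N}" "d m' < real b powr (- w * real N)" using N0(2)[OF N(1)] by blast
    then have ex: "\<exists>m. 1 \<le> m \<and> d m < d n" using N(2) by (intro exI[of _ m']) auto
    define m where "m = (LEAST m. 1 \<le> m \<and> d m < d n)"
    have m: "1 \<le> m" "d m < d n" using LeastI_ex[OF ex] unfolding m_def by auto
    have least: "d n \<le> d i" if "1 \<le> i" "i < m" for i
      using not_less_Least[of i "\<lambda>m. 1 \<le> m \<and> d m < d n"] that unfolding m_def by auto
    have mgt: "max n N0 < m"
      using \<open>P n\<close> m unfolding P_def by (meson atLeastAtMost_iff leD not_le)
    have "P m"
      unfolding P_def
    proof (intro conjI ballI)
      fix i assume "i \<in> {1..max m N0}"
      then have "1 \<le> i" "i \<le> m" using mgt by auto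
      then show "d m \<le> d i" using least[of i] m by (cases "i = m") auto
    qed (use m in auto)
    moreover have "Q n m"
      unfolding Q_def
    proof (intro conjI)
      show "n < m" using mgt by simp
      \<comment> \<open>Up to \<open>m - 1\<close> the smallest distance is still
        \<open>d n\<close>, so the hypothesis at \<open>m - 1\<close> bounds \<open>d n\<close>
        itself. Passing from \<open>m - 1\<close> to \<open>m\<close> costs at most a factor
        \<open>b\<close>, as \<open>w < 1\<close>.\<close>
      have "N0 \<le> m - 1" using mgt by (simp add: max_def split: if_splits)
      then obtain i where "i \<in> {1..m - 1}" "d i < real b powr (- w * real (m - 1))"
        using N0(2) by blast
      then have small: "d n < real b powr (- w * real (m - 1))"
        using least[of i] m(1) by fastforce
      also have "\<dots> \<le> real b powr (1 - w * real m)"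
        using b w m(1) by (intro powr_mono) (auto simp: of_nat_diff algebra_simps)
      finally show "d n \<le> real b powr (1 - w * real m)" by simp
      have dm: "d m = nearest_int_dist (real (b ^ (m - n)) * (real b ^ n * \<xi>))"
        using \<open>n < m\<close> by (simp add: d_def mult.assoc[symmetric] power_add[symmetric])
      \<comment> \<open>Otherwise the distance scales exactly from \<open>n\<close> to
        \<open>m\<close>, so it does not drop, and \<open>m\<close> is no new record.\<close>
      have "1 / 2 \<le> real (b ^ (m - n)) * d n"
      proof (rule ccontr)
        assume "\<not> ?thesis"
        then have "real (b ^ (m - n)) * nearest_int_dist (real b ^ n * \<xi>) < 1 / 2"
          unfolding d_def by simp
        then have "d m = real (b ^ (m - n)) * d n"
          unfolding dm by (subst nearest_int_dist_mult_eq) (simp_all add: d_def)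
        moreover have "1 * d n \<le> real (b ^ (m - n)) * d n"
          using b dpos[of n] by (intro mult_right_mono) auto
        ultimately show False using m(2) by simp
      qed
      also have "\<dots> \<le> real (b ^ (m - n)) * real b powr (- w * real (m - 1))"
        using small by (intro mult_left_mono) auto
      also have "\<dots> = real b powr (real (m - n) - w * real (m - 1))"
        using b by (simp add: powr_realpow[symmetric] powr_add[symmetric])
      finally have *: "1 / 2 \<le> real b powr (real (m - n) - w * real (m - 1))" .
      \<comment> \<open>Replacing 1/2 by \<open>b powr (-1)\<close> costs 1 in the exponent and
        using \<open>m - 1\<close> for \<open>m\<close> costs \<open>w\<close>; this is where the
        constant 2 comes from.\<close>
      have "real b powr (-1) \<le> 1 / 2" using b by (simp add: powr_minus field_simps)
      then have "real b powr (-1) \<le> real b powr (real (m - n) - w * real (m - 1))"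
        using * by linarith
      then have "-1 \<le> real (m - n) - w * real (m - 1)"
        using b by (subst (asm) powr_le_cancel_iff) auto
      then show "real n \<le> (1 - w) * real m + 2"
        using \<open>n < m\<close> w by (simp add: of_nat_diff algebra_simps)
    qed
    ultimately show ?thesis by blast
  qed
  have "\<exists>f. \<forall>n. P (f n) \<and> Q (f n) (f (Suc n))"
    by (rule dependent_nat_choice) (use start step in auto)
  then obtain f where "\<And>n. Q (f n) (f (Suc n))" by blast
  then show ?thesis using that[of f] unfolding Q_def d_def by blast
qed

text \<open>
  The left-hand side is, up to lower order terms, the logarithm to base \<open>b\<close> of the number of
  intervals needed at stage \<open>k\<close>. If the inequality failed from some point on, the ratios \<open>r k\<close> of
  consecutive partial sums \<open>T k\<close> would satisfy \<open>A * r (k + 1) < D - B / r k\<close>. The hypothesis on \<open>s\<close> says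
  that \<open>A * x + B / x = D\<close> has no real solution, so the ratios would decrease by a fixed amount at each step.
\<close>

lemma infinitely_often_few_free_digits:
  fixes n :: "nat \<Rightarrow> real"
  assumes w: "0 < w" "w < 1" and s: "0 < s" "s < 1" and ws: "(1 - w)\<^sup>2 < s * (1 + w)\<^sup>2"
    and pos: "\<And>j. 0 < n j"
  shows "\<exists>k\<ge>K. n k - w * (\<Sum>j\<in>{1..k}. n j) \<le> s * (n k + w * n (Suc k))"
proof (rule ccontr)
  assume "\<not> ?thesis"
  then have contr: "s * (n k + w * n (Suc k)) < n k - w * (\<Sum>j\<in>{1..k}. n j)" if "K \<le> k" for k
    using that by force
  define T where "T k = (\<Sum>j\<in>{1..k}. n j)" for k
  have T_Suc: "T (Suc k) = T k + n (Suc k)" for k by (simp add: T_def)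
  have Tpos: "0 < T k" if "1 \<le> k" for k
    unfolding T_def using that pos by (intro sum_pos) auto
  define r where "r k = T (Suc k) / T k" for k
  \<comment> \<open>\<open>A\<close>, \<open>B\<close> and \<open>D\<close> are, up to sign, the
    coefficients of \<open>T (k + 2)\<close>, \<open>T k\<close> and \<open>T (k + 1)\<close> when
    the inequality at \<open>k + 1\<close> is written in partial sums.\<close>
  define A where "A = s * w"
  define B where "B = 1 - s"
  define D where "D = (1 - s) * (1 - w)"
  have AB: "0 < A" "0 < B" "0 < D" using w s by (auto simp: A_def B_def D_def)
  \<comment> \<open>Cancelling \<open>1 - s\<close> leaves
    \<open>(1 - w)\<^sup>2 * (1 - s) < 4 * s * w\<close>, which is \<open>ws\<close> because
    \<open>(1 + w)\<^sup>2 - (1 - w)\<^sup>2 = 4 * w\<close>. The value of the dimension originates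
    here.\<close>
  have "D\<^sup>2 < 4 * A * B"
  proof -
    have "(1 - w)\<^sup>2 * (1 - s) < 4 * s * w"
      using ws by (simp add: power2_eq_square algebra_simps)
    then have "(1 - s) * ((1 - w)\<^sup>2 * (1 - s)) < (1 - s) * (4 * s * w)"
      using s by (intro mult_strict_left_mono) auto
    then show ?thesis by (simp add: A_def B_def D_def power2_eq_square algebra_simps)
  qed
  then have "D < 2 * sqrt (A * B)"
    using AB real_less_rsqrt[of D "4 * A * B"] by (simp add: real_sqrt_mult)
  define d where "d = (2 * sqrt (A * B) - D) / A"
  have d: "0 < d" using \<open>D < 2 * sqrt (A * B)\<close> AB by (simp add: d_def)
  have amgm: "2 * sqrt (A * B) \<le> A * x + B / x" if "0 < x" for x
  proof -
    have "0 \<le> (sqrt (A * x) - sqrt (B / x))\<^sup>2" by simp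
    also have "\<dots> = A * x + B / x - 2 * sqrt (A * x * (B / x))"
      using AB that by (simp add: power2_diff real_sqrt_mult[symmetric])
    also have "A * x * (B / x) = A * B" using that by simp
    finally show ?thesis by simp
  qed
  have decr: "r (Suc k) \<le> r k - d" if "K \<le> k" "1 \<le> k" for k
  proof -
    have "s * (n (Suc k) + w * n (Suc (Suc k))) < n (Suc k) - w * T (Suc k)"
      using contr[of "Suc k"] that unfolding T_def by simp
    moreover have "n (Suc k) = T (Suc k) - T k" "n (Suc (Suc k)) = T (Suc (Suc k)) - T (Suc k)"
      using T_Suc[of k] T_Suc[of "Suc k"] by auto
    ultimately have "A * T (Suc (Suc k)) < D * T (Suc k) - B * T k"
      by (simp add: A_def B_def D_def algebra_simps)
    moreover have rk: "0 < T k" "0 < T (Suc k)" using Tpos that by auto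
    ultimately have "A * r (Suc k) < D - B / r k"
      by (simp add: r_def field_simps)
    also have "\<dots> \<le> D - (2 * sqrt (A * B) - A * r k)"
      using amgm[of "r k"] rk by (simp add: r_def)
    also have "\<dots> = A * (r k - d)"
      using AB by (simp add: d_def field_simps)
    finally show ?thesis using AB by simp
  qed
  define k0 where "k0 = max K 1"
  have "r (k0 + i) \<le> r k0 - real i * d" for i
  proof (induction i)
    case (Suc i)
    have "r (Suc (k0 + i)) \<le> r (k0 + i) - d" by (rule decr) (auto simp: k0_def)
    then show ?case using Suc by (simp add: algebra_simps)
  qed simp
  moreover obtain i where "r k0 < real i * d"
    using d reals_Archimedean3 by blast
  ultimately have "r (k0 + i) < 0" by (metis diff_less_0_iff_less le_less_trans)
  moreover have "0 < r (k0 + i)"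
    using Tpos[of "k0 + i"] Tpos[of "Suc (k0 + i)"] by (simp add: r_def k0_def)
  ultimately show False by simp
qed

section \<open>Covers of the points with prescribed record times\<close>

lemma cover_approximable_points:
  fixes z :: real
  assumes "b > 0" "0 \<le> \<rho>" "0 < t"
  obtains C where "finite C" "real (card C) \<le> 2 * \<rho> * real b ^ n + 2"
    "{\<xi> \<in> cball z \<rho>. nearest_int_dist (real b ^ n * \<xi>) \<le> t} \<subseteq> (\<Union>c\<in>C. cball c (t / real b ^ n))"
proof
  let ?B = "real b ^ n"
  have B: "0 < ?B" using assms(1) by simp
  \<comment> \<open>The integer nearest to \<open>b ^ n * \<xi>\<close> is at most 1/2 away, so it
    lies in an interval of length \<open>2 * \<rho> * b ^ n + 1\<close>.\<close>
  define I where "I = {\<lceil>?B * (z - \<rho>) - 1 / 2\<rceil>..\<lfloor>?B * (z + \<rho>) + 1 / 2\<rfloor>}"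
  show "finite ((\<lambda>p. of_int p / ?B) ` I)" by (simp add: I_def)
  have "card ((\<lambda>p. of_int p / ?B) ` I) \<le> card I" by (intro card_image_le) (simp add: I_def)
  also have "real (card I) \<le> max 0 (?B * (z + \<rho>) + 1 / 2 - (?B * (z - \<rho>) - 1 / 2) + 1)"
    unfolding I_def by (simp add: of_nat_nat) linarith
  also have "\<dots> = 2 * \<rho> * ?B + 2"
    using assms(2) B by (simp add: algebra_simps)
  finally show "real (card ((\<lambda>p. of_int p / ?B) ` I)) \<le> 2 * \<rho> * ?B + 2" by simp
  show "{\<xi> \<in> cball z \<rho>. nearest_int_dist (?B * \<xi>) \<le> t}
      \<subseteq> (\<Union>c\<in>(\<lambda>p. of_int p / ?B) ` I. cball c (t / ?B))"
  proof safe
    fix \<xi> assume \<xi>: "\<xi> \<in> cball z \<rho>" "nearest_int_dist (?B * \<xi>) \<le> t"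
    obtain p where p: "nearest_int_dist (?B * \<xi>) = \<bar>?B * \<xi> - of_int p\<bar>"
      using nearest_int_dist_attained by blast
    have "?B * (z - \<rho>) \<le> ?B * \<xi>" "?B * \<xi> \<le> ?B * (z + \<rho>)"
      using \<xi>(1) B by (auto simp: dist_real_def intro!: mult_left_mono)
    moreover have "\<bar>?B * \<xi> - of_int p\<bar> \<le> 1 / 2" using p nearest_int_dist_le_half by metis
    ultimately have "?B * (z - \<rho>) - 1 / 2 \<le> of_int p" "of_int p \<le> ?B * (z + \<rho>) + 1 / 2"
      by linarith+
    then have "p \<in> I" unfolding I_def by (auto simp: ceiling_le_iff le_floor_iff)
    moreover have "\<xi> \<in> cball (of_int p / ?B) (t / ?B)"
    proof -
      have "\<xi> - of_int p / ?B = (?B * \<xi> - of_int p) / ?B" using B by (simp add: field_simps)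
      then have "\<bar>\<xi> - of_int p / ?B\<bar> = \<bar>?B * \<xi> - of_int p\<bar> / ?B"
        using B by simp
      then show ?thesis using \<xi>(2) p B by (simp add: dist_real_def abs_minus_commute divide_right_mono)
    qed
    ultimately show "\<xi> \<in> (\<Union>c\<in>(\<lambda>p. of_int p / ?B) ` I. cball c (t / ?B))" by blast
  qed
qed

text \<open>Keeps what \<open>record_sequence\<close> guarantees at the first \<open>k + 1\<close>
  record times; the unit ball makes finite covers possible.\<close>

definition chain_approx_set :: "nat \<Rightarrow> real \<Rightarrow> real \<Rightarrow> (nat \<Rightarrow> nat) \<Rightarrow> nat \<Rightarrow> real set" where
  "chain_approx_set b w z n k = {\<xi> \<in> cball z 1. \<forall>j\<le>k.
     nearest_int_dist (real b ^ n j * \<xi>) \<le> real b powr (1 - w * real (n (Suc j)))}"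

text \<open>An interval of stage \<open>k\<close> has length about \<open>b\<close> to the power
  \<open>- n k - w * n (k + 1)\<close> and so meets about \<open>b\<close> to the power
  \<open>(1 - w) * n (k + 1) - n k\<close> intervals of the next stage. The product over the stages
  telescopes; each factor \<open>4 * b ^ 2\<close> absorbs additive constants and rounding.\<close>

lemma cover_chain_approx_set:
  assumes b: "b \<ge> 2" and chain: "\<And>j. j \<le> k \<Longrightarrow> real (n j) \<le> (1 - w) * real (n (Suc j)) + 2"
  shows "\<exists>C. finite C \<and>
    real (card C) \<le> (4 * real b ^ 2) ^ Suc k * real b powr (real (n k) - w * (\<Sum>j\<in>{1..k}. real (n j))) \<and>
    chain_approx_set b w z n k \<subseteq> (\<Union>c\<in>C. cball c (real b powr (1 - w * real (n (Suc k)) - real (n k))))"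
  using chain
proof (induction k)
  case 0
  obtain C where C: "finite C" "real (card C) \<le> 2 * 1 * real b ^ n 0 + 2"
    "{\<xi> \<in> cball z 1. nearest_int_dist (real b ^ n 0 * \<xi>) \<le> real b powr (1 - w * real (n (Suc 0)))}
       \<subseteq> (\<Union>c\<in>C. cball c (real b powr (1 - w * real (n (Suc 0))) / real b ^ n 0))"
    using b by (rule_tac cover_approximable_points[of b 1 "real b powr (1 - w * real (n (Suc 0)))"]) auto
  have "real (card C) \<le> 4 * real b ^ n 0"
  proof -
    have "1 \<le> real b ^ n 0" using b by simp
    then show ?thesis using C(2) by linarith
  qed
  also have "\<dots> \<le> (4 * real b ^ 2) * real b ^ n 0"
    using b by (intro mult_right_mono) (auto simp: one_le_power)
  finally have "real (card C) \<le> (4 * real b ^ 2) ^ Suc 0 * real b powr (real (n 0) - w * (\<Sum>j\<in>{1..0}. real (n j)))"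
    using b by (simp add: powr_realpow)
  moreover have "real b powr (1 - w * real (n (Suc 0))) / real b ^ n 0
      = real b powr (1 - w * real (n (Suc 0)) - real (n 0))"
    using b by (simp add: powr_diff powr_realpow)
  ultimately show ?case using C by (intro exI[of _ C]) (auto simp: chain_approx_set_def)
next
  case (Suc k)
  let ?r = "real b powr (1 - w * real (n (Suc k)) - real (n k))"
  let ?t = "real b powr (1 - w * real (n (Suc (Suc k))))"
  let ?x = "(1 - w) * real (n (Suc k)) - real (n k)"
  obtain C where C: "finite C" "real (card C) \<le> (4 * real b ^ 2) ^ Suc k *
      real b powr (real (n k) - w * (\<Sum>j\<in>{1..k}. real (n j)))"
    "chain_approx_set b w z n k \<subseteq> (\<Union>c\<in>C. cball c ?r)"
    using Suc by (metis le_SucI)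
  define good where "good c C' \<longleftrightarrow> finite C' \<and> real (card C') \<le> 2 * ?r * real b ^ n (Suc k) + 2 \<and>
     {\<xi> \<in> cball c ?r. nearest_int_dist (real b ^ n (Suc k) * \<xi>) \<le> ?t}
       \<subseteq> (\<Union>c\<in>C'. cball c (?t / real b ^ n (Suc k)))" for c :: real and C' :: "real set"
  have "\<exists>C'. good c C'" for c
  proof (rule cover_approximable_points[of b ?r ?t "n (Suc k)" c])
    fix C' :: "real set"
    assume "finite C'" "real (card C') \<le> 2 * ?r * real b ^ n (Suc k) + 2"
      "{\<xi> \<in> cball c ?r. nearest_int_dist (real b ^ n (Suc k) * \<xi>) \<le> ?t}
         \<subseteq> (\<Union>c\<in>C'. cball c (?t / real b ^ n (Suc k)))"
    then show ?thesis unfolding good_def by blast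
  qed (use b in auto)
  then have "\<exists>C'. \<forall>c. good c (C' c)" by (intro choice allI)
  then obtain C' where "\<And>c. good c (C' c)" by blast
  then have C': "\<And>c. finite (C' c)" "\<And>c. real (card (C' c)) \<le> 2 * ?r * real b ^ n (Suc k) + 2"
    "\<And>c. {\<xi> \<in> cball c ?r. nearest_int_dist (real b ^ n (Suc k) * \<xi>) \<le> ?t}
       \<subseteq> (\<Union>c\<in>C' c. cball c (?t / real b ^ n (Suc k)))"
    unfolding good_def by auto
  have count: "2 * ?r * real b ^ n (Suc k) + 2 \<le> (4 * real b ^ 2) * real b powr ?x"
  proof -
    have "?r * real b ^ n (Suc k) = real b powr (1 + ?x)"
      using b by (simp add: powr_realpow[symmetric] powr_add[symmetric] algebra_simps)
    also have "\<dots> \<le> real b powr (2 + ?x)" using b by (intro powr_mono) auto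
    finally have 1: "?r * real b ^ n (Suc k) \<le> real b powr (2 + ?x)" .
    \<comment> \<open>The growth condition \<open>chain\<close> at \<open>k\<close> says
      \<open>2 + ?x \<ge> 0\<close>, which turns the additive 2 in the count into a factor.\<close>
    have "real b powr 0 \<le> real b powr (2 + ?x)"
      using b Suc.prems[of k] by (intro powr_mono) auto
    then have "2 * ?r * real b ^ n (Suc k) + 2 \<le> 4 * real b powr (2 + ?x)"
      using 1 b by simp
    also have "\<dots> = (4 * real b ^ 2) * real b powr ?x"
      using b by (simp add: powr_add)
    finally show ?thesis .
  qed
  have sub: "chain_approx_set b w z n (Suc k) \<subseteq> (\<Union>c\<in>(\<Union>c\<in>C. C' c). cball c (?t / real b ^ n (Suc k)))"
  proof
    fix \<xi> assume "\<xi> \<in> chain_approx_set b w z n (Suc k)"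
    then have \<xi>: "\<xi> \<in> chain_approx_set b w z n k" "nearest_int_dist (real b ^ n (Suc k) * \<xi>) \<le> ?t"
      unfolding chain_approx_set_def by auto
    then obtain c where "c \<in> C" "\<xi> \<in> cball c ?r" using C(3) by blast
    then have "\<xi> \<in> (\<Union>c\<in>C' c. cball c (?t / real b ^ n (Suc k)))" using C'(3)[of c] \<xi>(2) by blast
    then show "\<xi> \<in> (\<Union>c\<in>(\<Union>c\<in>C. C' c). cball c (?t / real b ^ n (Suc k)))" using \<open>c \<in> C\<close> by blast
  qed
  have "real (card (\<Union>c\<in>C. C' c)) \<le> real (\<Sum>c\<in>C. card (C' c))"
    by (intro of_nat_mono card_UN_le C)
  also have "\<dots> = (\<Sum>c\<in>C. real (card (C' c)))" by simp
  also have "\<dots> \<le> (\<Sum>c\<in>C. (4 * real b ^ 2) * real b powr ?x)"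
    by (intro sum_mono order_trans[OF C'(2) count])
  also have "\<dots> = real (card C) * ((4 * real b ^ 2) * real b powr ?x)" by simp
  also have "\<dots> \<le> ((4 * real b ^ 2) ^ Suc k * real b powr (real (n k) - w * (\<Sum>j\<in>{1..k}. real (n j))))
      * ((4 * real b ^ 2) * real b powr ?x)"
    by (intro mult_right_mono C) auto
  also have "\<dots> = (4 * real b ^ 2) ^ Suc (Suc k) *
      (real b powr (real (n k) - w * (\<Sum>j\<in>{1..k}. real (n j))) * real b powr ?x)"
    by (simp add: algebra_simps)
  also have "real b powr (real (n k) - w * (\<Sum>j\<in>{1..k}. real (n j))) * real b powr ?x
      = real b powr (real (n (Suc k)) - w * (\<Sum>j\<in>{1..Suc k}. real (n j)))"
    by (simp add: powr_add[symmetric] algebra_simps)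
  finally have card: "real (card (\<Union>c\<in>C. C' c)) \<le> (4 * real b ^ 2) ^ Suc (Suc k) *
      real b powr (real (n (Suc k)) - w * (\<Sum>j\<in>{1..Suc k}. real (n j)))" .
  have "?t / real b ^ n (Suc k) = real b powr (1 - w * real (n (Suc (Suc k))) - real (n (Suc k)))"
    using b by (simp add: powr_diff powr_realpow)
  then show ?case using sub card C(1) C'(1)
    by (intro exI[of _ "\<Union>c\<in>C. C' c"]) auto
qed

text \<open>This is the count times the weight of one interval. By \<open>few\<close> the exponent
  of the count is at most \<open>s'\<close> times that of the reciprocal length, so the gap
  \<open>s - s'\<close> survives as exponential decay in \<open>n (Suc k)\<close>. The power with
  exponent \<open>Suc k\<close> is harmless, since chains have logarithmic length.\<close>

lemma hausdorff_premeasure_chain_approx_set_le: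
  assumes b: "b \<ge> 2" and w: "0 < w" and s: "0 < s" "s' < s"
    and chain: "\<And>j. j \<le> k \<Longrightarrow> real (n j) \<le> (1 - w) * real (n (Suc j)) + 2"
    and few: "real (n k) - w * (\<Sum>j\<in>{1..k}. real (n j)) \<le> s' * (real (n k) + w * real (n (Suc k)))"
    and small: "2 * real b powr (1 - w * real (n (Suc k))) \<le> \<delta>"
  shows "hausdorff_premeasure s \<delta> (chain_approx_set b w z n k)
    \<le> ennreal ((2 * real b) powr s * (4 * real b ^ 2) ^ Suc k * real b powr (- ((s - s') * w) * real (n (Suc k))))"
proof -
  let ?r = "real b powr (1 - w * real (n (Suc k)) - real (n k))"
  let ?F = "real (n k) - w * (\<Sum>j\<in>{1..k}. real (n j))"
  let ?D = "4 * real b ^ 2"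
  obtain C where C: "finite C" "real (card C) \<le> ?D ^ Suc k * real b powr ?F"
    "chain_approx_set b w z n k \<subseteq> (\<Union>c\<in>C. cball c ?r)"
    using cover_chain_approx_set[of b k n w z] b chain by blast
  have \<delta>: "0 \<le> \<delta>" using small by (smt (verit) powr_ge_zero)
  have "?r \<le> real b powr (1 - w * real (n (Suc k)))" using b by (intro powr_mono) auto
  then have "2 * ?r \<le> \<delta>" using small by linarith
  with b have r: "0 < ?r" "2 * ?r \<le> \<delta>" by auto
  have "hausdorff_premeasure s \<delta> (chain_approx_set b w z n k) \<le> hausdorff_premeasure s \<delta> (\<Union>c\<in>C. cball c ?r)"
    by (rule hausdorff_premeasure_mono[OF C(3)])
  also have "\<dots> \<le> (\<Sum>c\<in>C. hausdorff_premeasure s \<delta> (cball c ?r))"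
    by (rule hausdorff_premeasure_finite_UN_le[OF C(1) \<delta>])
  also have "\<dots> \<le> (\<Sum>c\<in>C. ennreal ((2 * ?r) powr s))"
  proof (rule sum_mono)
    fix c :: real
    have "hausdorff_premeasure s \<delta> (cball c ?r) \<le> diam_weight s (cball c ?r)"
      using r \<delta> by (intro hausdorff_premeasure_le_diam_weight) auto
    also have "\<dots> = ennreal ((2 * ?r) powr s)"
      using r s by (simp add: diam_weight_def)
    finally show "hausdorff_premeasure s \<delta> (cball c ?r) \<le> ennreal ((2 * ?r) powr s)" .
  qed
  also have "\<dots> = ennreal (real (card C) * (2 * ?r) powr s)"
    by (simp add: ennreal_mult ennreal_of_nat_eq_real_of_nat)
  also have "\<dots> \<le> ennreal ((2 * real b) powr s * ?D ^ Suc k * real b powr (- ((s - s') * w) * real (n (Suc k))))"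
  proof (rule ennreal_leI)
    let ?y = "w * real (n (Suc k)) + real (n k)"
    have "?r = real b * real b powr (- ?y)"
      using b powr_add[of "real b" 1 "- ?y"] by (simp add: algebra_simps)
    then have r_powr: "(2 * ?r) powr s = (2 * real b) powr s * real b powr (- (s * ?y))"
      using b by (simp add: powr_mult powr_powr algebra_simps)
    have "real (card C) * (2 * ?r) powr s \<le> (?D ^ Suc k * real b powr ?F) * (2 * ?r) powr s"
      by (intro mult_right_mono C) auto
    also have "\<dots> = (2 * real b) powr s * ?D ^ Suc k * (real b powr ?F * real b powr (- (s * ?y)))"
      unfolding r_powr by (simp only: mult_ac)
    also have "real b powr ?F * real b powr (- (s * ?y)) = real b powr (?F - s * ?y)"
      by (simp add: powr_add[symmetric])
    also have "real b powr (?F - s * ?y) \<le> real b powr (- ((s - s') * w) * real (n (Suc k)))"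
    proof (rule powr_mono)
      have "?F - s * ?y \<le> s' * ?y - s * ?y" using few by (simp add: add.commute)
      also have "\<dots> \<le> - ((s - s') * w) * real (n (Suc k))"
        using s by (simp add: algebra_simps mult_right_mono)
      finally show "?F - s * ?y \<le> - ((s - s') * w) * real (n (Suc k))" .
    qed (use b in simp)
    finally show "real (card C) * (2 * ?r) powr s
        \<le> (2 * real b) powr s * ?D ^ Suc k * real b powr (- ((s - s') * w) * real (n (Suc k)))"
      by (simp add: mult_left_mono)
  qed
  finally show ?thesis .
qed

text \<open>The map taking \<open>x\<close> to \<open>(1 - w) * x + 2\<close> has the fixed point
  \<open>2 / w\<close>. Measured from it, the record times grow at least by the factor
  \<open>1 / (1 - w)\<close> per step.\<close>

lemma chain_length_le:
  fixes n :: "nat \<Rightarrow> nat"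
  assumes w: "0 < w" "w < 1"
    and chain: "\<And>j. j < m \<Longrightarrow> n j < n (Suc j) \<and> real (n j) \<le> (1 - w) * real (n (Suc j)) + 2"
    and pos: "1 \<le> n m"
  shows "real m \<le> 2 / w + 2 + ln (real (n m)) / ln (1 / (1 - w))"
proof -
  define q where "q = 1 / (1 - w)"
  have q: "1 < q" using w by (simp add: q_def)
  \<comment> \<open>Strict increase alone brings the chain to at least \<open>2 / w + 1\<close>
    after \<open>j0\<close> steps; from there the geometric growth can start at 1.\<close>
  define j0 where "j0 = nat \<lceil>2 / w\<rceil> + 1"
  have j0: "2 / w + 1 \<le> real j0" "real j0 \<le> 2 / w + 2"
    unfolding j0_def using w by (auto simp: of_nat_nat) linarith+
  have ge: "j \<le> n j" if "j \<le> m" for j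
    using that
  proof (induction j)
    case (Suc j)
    then show ?case using chain[of j] by simp
  qed simp
  have grow: "q ^ i \<le> real (n (j0 + i)) - 2 / w" if "j0 + i \<le> m" for i
    using that
  proof (induction i)
    case 0
    then show ?case using ge[of j0] j0 by simp
  next
    case (Suc i)
    have "real (n (j0 + i)) \<le> (1 - w) * real (n (Suc (j0 + i))) + 2"
      using chain[of "j0 + i"] Suc by simp
    then have "real (n (j0 + i)) - 2 / w \<le> (1 - w) * (real (n (Suc (j0 + i))) - 2 / w)"
    proof -
      have "(1 - w) * (2 / w) = 2 / w - 2" using w by (simp add: field_simps)
      then show ?thesis using \<open>real (n (j0 + i)) \<le> _\<close> by (simp only: right_diff_distrib)
    qed
    then have "q * (real (n (j0 + i)) - 2 / w) \<le> q * ((1 - w) * (real (n (Suc (j0 + i))) - 2 / w))"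
      using q by (intro mult_left_mono) auto
    also have "\<dots> = real (n (Suc (j0 + i))) - 2 / w" using w by (simp add: q_def)
    finally have "q * (real (n (j0 + i)) - 2 / w) \<le> real (n (Suc (j0 + i))) - 2 / w" .
    moreover have "q * q ^ i \<le> q * (real (n (j0 + i)) - 2 / w)"
      using Suc q by (intro mult_left_mono) auto
    ultimately show ?case by simp
  qed
  show ?thesis
  proof (cases "m \<le> j0")
    case True
    have "0 \<le> ln (real (n m)) / ln (1 / (1 - w))"
      using pos q by (auto simp: q_def intro!: divide_nonneg_nonneg)
    then show ?thesis using True j0 by (smt (verit) of_nat_mono)
  next
    case False
    define i where "i = m - j0"
    have "q ^ i \<le> real (n m) - 2 / w" using grow[of i] False by (simp add: i_def)
    then have "q ^ i \<le> real (n m)" using w by (smt (verit) divide_pos_pos)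
    then have "ln (q ^ i) \<le> ln (real (n m))"
      using q pos by (subst ln_le_cancel_iff) auto
    then have "real i * ln q \<le> ln (real (n m))" using q by (simp add: ln_realpow)
    then have "real i \<le> ln (real (n m)) / ln q" using q by (simp add: field_simps)
    then show ?thesis using False j0 unfolding i_def q_def by (simp add: of_nat_diff)
  qed
qed

text \<open>The factors are the number of list lengths, the number of chains with their covering
  constants, a diameter constant and the decay. All but the last are together at most the
  exponential of a multiple of \<open>(ln N)\<^sup>2\<close>, and half of the decay outweighs
  that.\<close>

lemma subexponential_bound:
  fixes A B L E c :: real
  assumes "0 < A" "0 < B" "0 < L" "0 < E" "0 < c"
  shows "\<forall>\<^sub>F N :: nat in sequentially.
    (A + B * ln (real N) + 1) * exp ((A + B * ln (real N)) * (ln (real N + 1) + L)) * E * exp (- 2 * c * real N)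
      \<le> exp (- c * real N)"
  using assms by real_asymp

text \<open>
  Chains of record times are encoded as lists, so that those ending at \<open>N\<close> form a finite set. Their entries
  grow geometrically, hence their number is subexponential in \<open>N\<close> and does not affect the dimension.
\<close>

definition free_digit_chains :: "real \<Rightarrow> real \<Rightarrow> nat \<Rightarrow> nat list set" where
  "free_digit_chains w s' N = {xs. \<exists>k. length xs = k + 2 \<and> xs ! Suc k = N \<and>
      (\<forall>j\<le>k. xs ! j < xs ! Suc j \<and> real (xs ! j) \<le> (1 - w) * real (xs ! Suc j) + 2) \<and>
      real (xs ! k) - w * (\<Sum>j\<in>{1..k}. real (xs ! j)) \<le> s' * (real (xs ! k) + w * real N)}"

lemma chain_le_last:
  fixes f :: "nat \<Rightarrow> nat"
  assumes "\<And>j. j \<le> k \<Longrightarrow> f j < f (Suc j)" "j \<le> Suc k"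
  shows "f j \<le> f (Suc k)"
  using assms(2)
proof (induction rule: inc_induct)
  case (step j)
  then show ?case using assms(1)[of j] by simp
qed simp

lemma free_digit_chains_subset:
  assumes w: "0 < w" "w < 1" and N: "1 \<le> N"
  shows "free_digit_chains w s' N \<subseteq>
    {xs. set xs \<subseteq> {..N} \<and> length xs \<le> nat \<lceil>2 / w + 3 + ln (real N) / ln (1 / (1 - w))\<rceil>}"
proof
  fix xs assume "xs \<in> free_digit_chains w s' N"
  then obtain k where k: "length xs = k + 2" "xs ! Suc k = N"
    "\<And>j. j \<le> k \<Longrightarrow> xs ! j < xs ! Suc j \<and> real (xs ! j) \<le> (1 - w) * real (xs ! Suc j) + 2"
    unfolding free_digit_chains_def by blast
  have "set xs \<subseteq> {..N}"
  proof
    fix x assume "x \<in> set xs"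
    then obtain j where "j < length xs" "x = xs ! j" by (metis in_set_conv_nth)
    then show "x \<in> {..N}" using chain_le_last[of k "(!) xs" j] k by auto
  qed
  moreover have "real (Suc k) \<le> 2 / w + 2 + ln (real N) / ln (1 / (1 - w))"
    using chain_length_le[OF w, of "Suc k" "(!) xs"] k N by auto
  then have "real (length xs) \<le> 2 / w + 3 + ln (real N) / ln (1 / (1 - w))" using k(1) by simp
  then have "length xs \<le> nat \<lceil>2 / w + 3 + ln (real N) / ln (1 / (1 - w))\<rceil>" by linarith
  ultimately show "xs \<in> {xs. set xs \<subseteq> {..N} \<and> length xs \<le> nat \<lceil>2 / w + 3 + ln (real N) / ln (1 / (1 - w))\<rceil>}"
    by simp
qed

lemma card_free_digit_chains_le:
  assumes w: "0 < w" "w < 1" and N: "1 \<le> N"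
    and \<kappa>: "\<kappa> = nat \<lceil>2 / w + 3 + ln (real N) / ln (1 / (1 - w))\<rceil>"
  shows "finite (free_digit_chains w s' N)"
    "real (card (free_digit_chains w s' N)) \<le> (real \<kappa> + 1) * (real N + 1) ^ \<kappa>"
proof -
  let ?X = "{xs. set xs \<subseteq> {..N} \<and> length xs \<le> \<kappa>}"
  have sub: "free_digit_chains w s' N \<subseteq> ?X"
    using free_digit_chains_subset[OF w N] \<kappa> by simp
  have fin: "finite ?X" by (rule finite_lists_length_le) simp
  then show "finite (free_digit_chains w s' N)" using sub by (rule rev_finite_subset)
  have "card (free_digit_chains w s' N) \<le> card ?X" by (rule card_mono[OF fin sub])
  also have "\<dots> = (\<Sum>i\<le>\<kappa>. Suc N ^ i)" by (subst card_lists_length_le) auto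
  also have "\<dots> \<le> (\<Sum>i\<le>\<kappa>. Suc N ^ \<kappa>)" by (intro sum_mono power_increasing) auto
  also have "\<dots> = (\<kappa> + 1) * Suc N ^ \<kappa>" by simp
  finally have "real (card (free_digit_chains w s' N)) \<le> real ((\<kappa> + 1) * Suc N ^ \<kappa>)"
    by (rule of_nat_mono)
  then show "real (card (free_digit_chains w s' N)) \<le> (real \<kappa> + 1) * (real N + 1) ^ \<kappa>"
    by (simp add: algebra_simps)
qed

lemma hausdorff_premeasure_level_le:
  assumes b: "b \<ge> 2" and w: "0 < w" "w < 1" and s: "0 < s" "s' < s" and \<delta>: "0 < \<delta>"
  shows "\<exists>c>0. \<forall>\<^sub>F N in sequentially. hausdorff_premeasure s \<delta>
      (\<Union>xs\<in>free_digit_chains w s' N. chain_approx_set b w z ((!) xs) (length xs - 2)) \<le> ennreal (exp (- c * real N))"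
proof -
  \<comment> \<open>To the \<open>2 / w + 2\<close> of \<open>chain_length_le\<close> one is added
    because a list has one entry more than steps, and one for rounding up.\<close>
  define A where "A = 2 / w + 4"
  define B where "B = 1 / ln (1 / (1 - w))"
  define D where "D = 4 * real b ^ 2"
  define E where "E = (2 * real b) powr s"
  \<comment> \<open>The decay is \<open>exp (- 2 * c * N)\<close>; one half of it is set aside
    against the number of chains.\<close>
  define c where "c = (s - s') * w * ln (real b) / 2"
  have "1 * 4 \<le> real b ^ 2 * 4" using b by (intro mult_right_mono one_le_power) auto
  then have D: "4 \<le> D" by (simp add: D_def)
  have pos: "0 < A" "0 < B" "0 < ln D" "0 < E" "0 < c"
    using w b s D by (auto simp: A_def B_def E_def c_def intro!: mult_pos_pos add_pos_pos)
  have "(\<lambda>N. 2 * real b powr (1 - w * real N)) \<longlonglongrightarrow> 0"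
  proof -
    have "(\<lambda>N. 2 * real b * (real b powr - w) ^ N) \<longlonglongrightarrow> 2 * real b * 0"
      using b w by (intro tendsto_mult tendsto_const LIMSEQ_power_zero) (auto simp: powr_less_one)
    moreover have "2 * real b powr (1 - w * real N) = 2 * real b * (real b powr - w) ^ N" for N
      using b by (simp add: powr_realpow[symmetric] powr_powr powr_diff powr_minus field_simps)
    ultimately show ?thesis by (simp only: mult_zero_right)
  qed
  then have "\<forall>\<^sub>F N in sequentially. 2 * real b powr (1 - w * real N) < \<delta>"
    using \<delta> by (rule order_tendstoD(2))
  then have "\<forall>\<^sub>F N in sequentially. hausdorff_premeasure s \<delta>
      (\<Union>xs\<in>free_digit_chains w s' N. chain_approx_set b w z ((!) xs) (length xs - 2)) \<le> ennreal (exp (- c * real N))"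
    using subexponential_bound[OF pos] eventually_ge_at_top[of 1]
  proof eventually_elim
    case (elim N)
    define \<kappa> where "\<kappa> = nat \<lceil>2 / w + 3 + ln (real N) / ln (1 / (1 - w))\<rceil>"
    let ?M = "E * D ^ \<kappa> * exp (- 2 * c * real N)"
    note card = card_free_digit_chains_le[OF w elim(3) \<kappa>_def, of s']
    have "0 \<le> ln (real N) / ln (1 / (1 - w))"
      using elim(3) pos(2) by (auto simp: B_def intro!: divide_nonneg_nonneg)
    then have \<kappa>: "real \<kappa> \<le> A + B * ln (real N)"
      unfolding \<kappa>_def A_def B_def using w by (simp add: of_nat_nat) linarith
    have single: "hausdorff_premeasure s \<delta> (chain_approx_set b w z ((!) xs) (length xs - 2)) \<le> ennreal ?M"
      if xs: "xs \<in> free_digit_chains w s' N" for xs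
    proof -
      obtain k where k: "length xs = k + 2" "xs ! Suc k = N"
        "\<forall>j\<le>k. xs ! j < xs ! Suc j \<and> real (xs ! j) \<le> (1 - w) * real (xs ! Suc j) + 2"
        "real (xs ! k) - w * (\<Sum>j\<in>{1..k}. real (xs ! j)) \<le> s' * (real (xs ! k) + w * real N)"
        using xs unfolding free_digit_chains_def by blast
      have "hausdorff_premeasure s \<delta> (chain_approx_set b w z ((!) xs) k)
         \<le> ennreal (E * D ^ Suc k * real b powr (- ((s - s') * w) * real N))"
        using hausdorff_premeasure_chain_approx_set_le[OF b w(1) s, of k "(!) xs" \<delta> z] k elim(1)
        unfolding E_def D_def by simp
      also have "real b powr (- ((s - s') * w) * real N) = exp (- 2 * c * real N)"
        using b by (simp add: powr_def c_def mult_ac)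
      also have "ennreal (E * D ^ Suc k * exp (- 2 * c * real N)) \<le> ennreal ?M"
      proof -
        have "length xs \<le> \<kappa>"
          using free_digit_chains_subset[OF w elim(3)] xs unfolding \<kappa>_def by blast
        then show ?thesis
          using k(1) D pos
          by (intro ennreal_leI mult_right_mono mult_left_mono power_increasing) auto
      qed
      finally show ?thesis using k(1) by simp
    qed
    have "hausdorff_premeasure s \<delta> (\<Union>xs\<in>free_digit_chains w s' N. chain_approx_set b w z ((!) xs) (length xs - 2))
        \<le> (\<Sum>xs\<in>free_digit_chains w s' N. hausdorff_premeasure s \<delta> (chain_approx_set b w z ((!) xs) (length xs - 2)))"
      using \<delta> by (intro hausdorff_premeasure_finite_UN_le card) auto
    also have "\<dots> \<le> (\<Sum>xs\<in>free_digit_chains w s' N. ennreal ?M)"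
      by (intro sum_mono single)
    also have "\<dots> = ennreal (real (card (free_digit_chains w s' N)) * ?M)"
      using pos D by (simp add: ennreal_mult ennreal_of_nat_eq_real_of_nat)
    also have "\<dots> \<le> ennreal (exp (- c * real N))"
    proof (rule ennreal_leI)
      have "real (card (free_digit_chains w s' N)) * ?M \<le> ((real \<kappa> + 1) * (real N + 1) ^ \<kappa>) * ?M"
        using pos D by (intro mult_right_mono card) auto
      also have "\<dots> = (real \<kappa> + 1) * exp (real \<kappa> * (ln (real N + 1) + ln D)) * E * exp (- 2 * c * real N)"
      proof -
        have "exp (real \<kappa> * (ln (real N + 1) + ln D)) = (real N + 1) ^ \<kappa> * D ^ \<kappa>"
          using D by (simp add: distrib_left exp_add exp_of_nat_mult)
        then show ?thesis by simp
      qed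
      also have "\<dots> \<le> (A + B * ln (real N) + 1) * exp ((A + B * ln (real N)) * (ln (real N + 1) + ln D)) * E * exp (- 2 * c * real N)"
      proof -
        have "real \<kappa> * (ln (real N + 1) + ln D) \<le> (A + B * ln (real N)) * (ln (real N + 1) + ln D)"
          using \<kappa> pos by (intro mult_right_mono add_nonneg_nonneg) auto
        then show ?thesis using \<kappa> pos by (intro mult_right_mono mult_mono) auto
      qed
      also have "\<dots> \<le> exp (- c * real N)" by (rule elim(2))
      finally show "real (card (free_digit_chains w s' N)) * ?M \<le> exp (- c * real N)" .
    qed
    finally show ?case .
  qed
  then show ?thesis using pos(5) by blast
qed

text \<open>Each point has good stages \<open>k\<close> beyond any bound, and the last record time
  of such a stage exceeds \<open>k\<close>; so the levels from \<open>M\<close> on suffice.\<close>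

lemma uniformly_approximable_subset_levels:
  assumes b: "b \<ge> 2" and w: "0 < w" "w < 1" and s': "0 < s'" "s' < 1" "(1 - w)\<^sup>2 < s' * (1 + w)\<^sup>2"
  shows "{\<xi> \<in> cball z 1. uniformly_approx b (\<lambda>n. n) w \<xi> \<and> (\<forall>n. nearest_int_dist (real b ^ n * \<xi>) \<noteq> 0)}
    \<subseteq> (\<Union>i. \<Union>xs\<in>free_digit_chains w s' (M + i). chain_approx_set b w z ((!) xs) (length xs - 2))"
proof safe
  fix \<xi> assume \<xi>: "\<xi> \<in> cball z 1" "uniformly_approx b (\<lambda>n. n) w \<xi>" "\<forall>n. nearest_int_dist (real b ^ n * \<xi>) \<noteq> 0"
  obtain n where n: "\<And>j. n j < n (Suc j)" "\<And>j. real (n j) \<le> (1 - w) * real (n (Suc j)) + 2"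
    "\<And>j. nearest_int_dist (real b ^ n j * \<xi>) \<le> real b powr (1 - w * real (n (Suc j)))"
    using record_sequence[OF b w \<xi>(2)] \<xi>(3) by metis
  have ge: "j \<le> n j" for j
  proof (induction j)
    case (Suc j)
    then show ?case using n(1)[of j] by simp
  qed simp
  \<comment> \<open>The record times are shifted by one: nothing obtained so far excludes
    \<open>n 0 = 0\<close>, and the ratio argument works with positive terms.\<close>
  have "\<exists>k\<ge>M. real (n (Suc k)) - w * (\<Sum>j\<in>{1..k}. real (n (Suc j))) \<le> s' * (real (n (Suc k)) + w * real (n (Suc (Suc k))))"
    using n(1) by (intro infinitely_often_few_free_digits w s') (metis gr_zeroI not_less0 of_nat_0_less_iff)
  then obtain k where k: "M \<le> k"
    "real (n (Suc k)) - w * (\<Sum>j\<in>{1..k}. real (n (Suc j))) \<le> s' * (real (n (Suc k)) + w * real (n (Suc (Suc k))))"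
    by blast
  define xs where "xs = map (\<lambda>j. n (Suc j)) [0..<k + 2]"
  have nth: "xs ! j = n (Suc j)" if "j \<le> Suc k" for j
    using that by (simp add: xs_def del: upt_Suc)
  have "(\<Sum>j\<in>{1..k}. real (xs ! j)) = (\<Sum>j\<in>{1..k}. real (n (Suc j)))"
    by (intro sum.cong) (auto simp: nth)
  then have "xs \<in> free_digit_chains w s' (n (Suc (Suc k)))"
    unfolding free_digit_chains_def using n k
    by (intro CollectI exI[of _ k]) (simp add: nth, simp add: xs_def)
  moreover have "\<xi> \<in> chain_approx_set b w z ((!) xs) (length xs - 2)"
  proof -
    have "length xs - 2 = k" by (simp add: xs_def)
    then show ?thesis using \<xi>(1) n(3) unfolding chain_approx_set_def by (simp add: nth)
  qed
  moreover have "n (Suc (Suc k)) = M + (n (Suc (Suc k)) - M)"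
    using ge[of "Suc (Suc k)"] k(1) by simp
  ultimately show "\<xi> \<in> (\<Union>i. \<Union>xs\<in>free_digit_chains w s' (M + i). chain_approx_set b w z ((!) xs) (length xs - 2))"
    by (metis UN_I UNIV_I)
qed

text \<open>A Borel-Cantelli argument: the bounds for the levels form a convergent geometric series,
  whose tail from \<open>M\<close> on tends to 0. Points with a vanishing distance are left out
  because their records stop.\<close>

lemma hausdorff_null_uniformly_approximable_irrational:
  assumes b: "b \<ge> 2" and w: "0 < w" "w < 1" and s: "((1 - w) / (1 + w))\<^sup>2 < s"
  shows "hausdorff_measure s
    {\<xi> \<in> cball z 1. uniformly_approx b (\<lambda>n. n) w \<xi> \<and> (\<forall>n. nearest_int_dist (real b ^ n * \<xi>) \<noteq> 0)} = 0"
    (is "hausdorff_measure s ?U = 0")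
  unfolding hausdorff_measure_eq_0_iff
proof (intro allI impI)
  fix \<delta> :: real assume \<delta>: "0 < \<delta>"
  have s0: "0 < s" using s by (rule le_less_trans[rotated]) simp
  have "((1 - w) / (1 + w))\<^sup>2 < 1"
    using w by (intro power_less_one_iff[THEN iffD2]) auto
  \<comment> \<open>The gap between \<open>s'\<close> and \<open>s\<close> produces the decay, and
    \<open>s' < 1\<close> is demanded by the ratio argument.\<close>
  then obtain s' where s': "((1 - w) / (1 + w))\<^sup>2 < s'" "s' < min s 1"
    using s dense by (metis min_less_iff_conj)
  have "0 < s'" using s'(1) by (rule le_less_trans[rotated]) simp
  moreover have "(1 - w)\<^sup>2 < s' * (1 + w)\<^sup>2"
    using s'(1) w by (simp add: power_divide field_simps)
  ultimately have sub: "?U \<subseteq> (\<Union>i. \<Union>xs\<in>free_digit_chains w s' (M + i). chain_approx_set b w z ((!) xs) (length xs - 2))" for M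
    using s'(2) by (intro uniformly_approximable_subset_levels b w) auto
  obtain c N0 where c: "0 < c" and N0: "\<And>N. N0 \<le> N \<Longrightarrow> hausdorff_premeasure s \<delta>
      (\<Union>xs\<in>free_digit_chains w s' N. chain_approx_set b w z ((!) xs) (length xs - 2)) \<le> ennreal (exp (- c * real N))"
    using hausdorff_premeasure_level_le[OF b w s0 _ \<delta>, of s' z] s'(2)
    unfolding eventually_sequentially by auto
  have sums: "(\<lambda>i. exp (- c * real (M + i))) sums (exp (- c * real M) * (1 / (1 - exp (- c))))" for M
  proof -
    have "(\<lambda>i. exp (- c * real M) * exp (- c) ^ i) sums (exp (- c * real M) * (1 / (1 - exp (- c))))"
      using c by (intro sums_mult geometric_sums) auto
    moreover have "exp (- c * real (M + i)) = exp (- c * real M) * exp (- c) ^ i" for i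
      by (simp add: exp_of_nat_mult[symmetric] exp_add[symmetric] algebra_simps)
    ultimately show ?thesis by simp
  qed
  have le: "hausdorff_premeasure s \<delta> ?U \<le> ennreal (exp (- c * real M) * (1 / (1 - exp (- c))))" if "N0 \<le> M" for M
  proof -
    have "hausdorff_premeasure s \<delta> ?U \<le> (\<Sum>i. hausdorff_premeasure s \<delta>
        (\<Union>xs\<in>free_digit_chains w s' (M + i). chain_approx_set b w z ((!) xs) (length xs - 2)))"
      using hausdorff_premeasure_mono[OF sub] hausdorff_premeasure_UN_le by (rule order_trans)
    also have "\<dots> \<le> (\<Sum>i. ennreal (exp (- c * real (M + i))))"
      using that by (intro suminf_le N0) auto
    also have "\<dots> = ennreal (exp (- c * real M) * (1 / (1 - exp (- c))))"
      using sums by (intro sums_unique[symmetric] sums_ennreal[THEN iffD2]) (auto simp: c less_imp_le)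
    finally show ?thesis .
  qed
  have "(\<lambda>M. ennreal (exp (- c * real M) * (1 / (1 - exp (- c))))) \<longlonglongrightarrow> ennreal 0"
    using c by (intro tendsto_ennrealI) real_asymp
  then have "hausdorff_premeasure s \<delta> ?U \<le> ennreal 0"
    using le by (intro tendsto_lowerbound[of _ _ sequentially]) (auto simp: eventually_sequentially)
  then show "hausdorff_premeasure s \<delta> ?U = 0" by simp
qed

lemma countable_nearest_int_dist_zero:
  assumes "b > 0"
  shows "countable {\<xi>. \<exists>n. nearest_int_dist (real b ^ n * \<xi>) = 0}"
proof (rule countable_subset)
  show "{\<xi>. \<exists>n. nearest_int_dist (real b ^ n * \<xi>) = 0} \<subseteq> range (\<lambda>(n, m). of_int m / real b ^ n)"
  proof safe
    fix \<xi> n assume "nearest_int_dist (real b ^ n * \<xi>) = 0"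
    then obtain m where "real b ^ n * \<xi> = of_int m"
      using nearest_int_dist_attained[of "real b ^ n * \<xi>"] by auto
    then have "\<xi> = (\<lambda>(n, m). of_int m / real b ^ n) (n, m)" using assms by (simp add: field_simps)
    then show "\<xi> \<in> range (\<lambda>(n, m). of_int m / real b ^ n)" by (rule range_eqI)
  qed
qed simp

lemma hausdorff_null_uniformly_approximable:
  assumes b: "b \<ge> 2" and w: "0 < w" "w < 1" and s: "((1 - w) / (1 + w))\<^sup>2 < s"
  shows "hausdorff_measure s {\<xi>. uniformly_approx b (\<lambda>n. n) w \<xi>} = 0"
proof (rule hausdorff_null_subset)
  let ?Q = "{\<xi>. \<exists>n. nearest_int_dist (real b ^ n * \<xi>) = 0}"
  let ?U = "\<lambda>z :: int. {\<xi> \<in> cball (of_int z) 1. uniformly_approx b (\<lambda>n. n) w \<xi> \<and> (\<forall>n. nearest_int_dist (real b ^ n * \<xi>) \<noteq> 0)}"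
  have "0 < s" using s by (rule le_less_trans[rotated]) simp
  then have Q: "hausdorff_measure s ?Q = 0"
    using b by (intro hausdorff_null_countable countable_nearest_int_dist_zero) auto
  have U: "hausdorff_measure s (\<Union>z. ?U z) = 0"
    by (intro hausdorff_null_countable_UN hausdorff_null_uniformly_approximable_irrational b w s) auto
  have "hausdorff_measure s (\<Union>X\<in>{?Q, \<Union>z. ?U z}. X) = 0"
    using Q U by (intro hausdorff_null_countable_UN) auto
  then show "hausdorff_measure s (?Q \<union> (\<Union>z. ?U z)) = 0" by simp
  show "{\<xi>. uniformly_approx b (\<lambda>n. n) w \<xi>} \<subseteq> ?Q \<union> (\<Union>z. ?U z)"
  proof
    fix \<xi> assume \<xi>: "\<xi> \<in> {\<xi>. uniformly_approx b (\<lambda>n. n) w \<xi>}"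
    have "\<xi> \<in> cball (of_int \<lfloor>\<xi>\<rfloor>) 1" by (simp add: dist_real_def) linarith
    then show "\<xi> \<in> ?Q \<union> (\<Union>z. ?U z)" using \<xi> by blast
  qed
qed

text \<open>Serves the case \<open>v = 0\<close> of the upper bound, where there is no
  \<open>w\<close> strictly between 0 and \<open>v\<close>.\<close>

lemma hausdorff_null_UNIV_real:
  assumes s: "1 < s"
  shows "hausdorff_measure s (UNIV :: real set) = 0"
proof -
  have "hausdorff_measure s (cball (of_int z) 1 :: real set) = 0" for z
    unfolding hausdorff_measure_eq_0_iff
  proof (intro allI impI)
    fix \<delta> :: real assume \<delta>: "0 < \<delta>"
    have le: "hausdorff_premeasure s \<delta> (cball (of_int z) 1 :: real set)
        \<le> ennreal ((2 * 2 ^ n + 2) * (1 / 2 ^ n) powr s)" if n: "1 / 2 ^ n \<le> \<delta>" for n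
    proof -
      \<comment> \<open>With \<open>t = 1/2\<close> approximability is no restriction, so the
        covering lemma in base 2 gives a plain cover by intervals of length
        \<open>1 / 2 ^ n\<close>.\<close>
      let ?r = "1 / 2 / real 2 ^ n"
      obtain C where C: "finite C" "real (card C) \<le> 2 * 1 * real 2 ^ n + 2"
        "{\<xi> \<in> cball (of_int z) 1. nearest_int_dist (real 2 ^ n * \<xi>) \<le> 1 / 2} \<subseteq> (\<Union>c\<in>C. cball c ?r)"
        by (rule cover_approximable_points[of 2 1 "1 / 2" n "of_int z"]) auto
      have "hausdorff_premeasure s \<delta> (cball (of_int z) 1 :: real set) \<le> hausdorff_premeasure s \<delta> (\<Union>c\<in>C. cball c ?r)"
        using C(3) nearest_int_dist_le_half by (intro hausdorff_premeasure_mono) auto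
      also have "\<dots> \<le> (\<Sum>c\<in>C. hausdorff_premeasure s \<delta> (cball c ?r))"
        using C(1) \<delta> by (intro hausdorff_premeasure_finite_UN_le) auto
      also have "\<dots> \<le> (\<Sum>c\<in>C. ennreal ((1 / 2 ^ n) powr s))"
      proof (rule sum_mono)
        fix c :: real
        have "hausdorff_premeasure s \<delta> (cball c ?r) \<le> diam_weight s (cball c ?r)"
          using n \<delta> by (intro hausdorff_premeasure_le_diam_weight) auto
        also have "\<dots> = ennreal ((1 / 2 ^ n) powr s)" using s by (simp add: diam_weight_def)
        finally show "hausdorff_premeasure s \<delta> (cball c ?r) \<le> ennreal ((1 / 2 ^ n) powr s)" .
      qed
      also have "\<dots> = ennreal (real (card C) * (1 / 2 ^ n) powr s)"
        by (simp add: ennreal_mult ennreal_of_nat_eq_real_of_nat)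
      also have "\<dots> \<le> ennreal ((2 * 2 ^ n + 2) * (1 / 2 ^ n) powr s)"
        using C(2) by (intro ennreal_leI mult_right_mono) auto
      finally show ?thesis .
    qed
    have "(\<lambda>n. 1 / 2 ^ n :: real) \<longlonglongrightarrow> 0" by real_asymp
    then have "\<forall>\<^sub>F n in sequentially. 1 / 2 ^ n < \<delta>" using \<delta> by (rule order_tendstoD(2))
    then have "\<forall>\<^sub>F n in sequentially. hausdorff_premeasure s \<delta> (cball (of_int z) 1 :: real set)
        \<le> ennreal ((2 * 2 ^ n + 2) * (1 / 2 ^ n) powr s)"
      by (rule eventually_mono) (rule le, simp)
    moreover have "(\<lambda>n. (2 * 2 ^ n + 2) * (1 / 2 ^ n) powr s) \<longlonglongrightarrow> 0"
      using s by real_asymp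
    then have "(\<lambda>n. ennreal ((2 * 2 ^ n + 2) * (1 / 2 ^ n) powr s)) \<longlonglongrightarrow> ennreal 0"
      by (intro tendsto_ennrealI)
    ultimately have "hausdorff_premeasure s \<delta> (cball (of_int z) 1 :: real set) \<le> ennreal 0"
      by (intro tendsto_lowerbound[of _ _ sequentially]) auto
    then show "hausdorff_premeasure s \<delta> (cball (of_int z) 1 :: real set) = 0" by simp
  qed
  then have "hausdorff_measure s (\<Union>z :: int. cball (of_int z) 1 :: real set) = 0"
    by (intro hausdorff_null_countable_UN) auto
  moreover have "UNIV \<subseteq> (\<Union>z :: int. cball (of_int z) 1 :: real set)"
  proof
    fix x :: real
    have "x \<in> cball (of_int \<lfloor>x\<rfloor>) 1" by (simp add: dist_real_def) linarith
    then show "x \<in> (\<Union>z :: int. cball (of_int z) 1)" by blast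
  qed
  ultimately show ?thesis by (rule hausdorff_null_subset)
qed

lemma hausdorff_dim_uniform_set_id_le:
  assumes b: "b \<ge> 2" and v: "0 \<le> v" "v \<le> 1"
  shows "hausdorff_dim (uniform_set b (\<lambda>n. n) v) \<le> ereal (((1 - v) / (1 + v))\<^sup>2)"
proof (rule hausdorff_dim_le)
  fix s assume s: "((1 - v) / (1 + v))\<^sup>2 < s"
  show "hausdorff_measure s (uniform_set b (\<lambda>n. n) v) = 0"
  proof (cases "v = 0")
    case True
    then show ?thesis using s by (auto intro: hausdorff_null_subset[OF hausdorff_null_UNIV_real])
  next
    case False
    \<comment> \<open>An exponent of at least \<open>v\<close> yields approximability only for
      \<open>w < v\<close>. Continuity provides such a \<open>w\<close>, which also lies below 1
      when \<open>v = 1\<close>.\<close>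
    have "((\<lambda>w. ((1 - w) / (1 + w))\<^sup>2) \<longlongrightarrow> ((1 - v) / (1 + v))\<^sup>2) (at_left v)"
      using v by (intro tendsto_intros) auto
    then have "\<forall>\<^sub>F w in at_left v. ((1 - w) / (1 + w))\<^sup>2 < s"
      using s by (rule order_tendstoD(2))
    moreover have "\<forall>\<^sub>F w in at_left v. w \<in> {0<..<v}"
      using v False by (intro eventually_at_left_real) auto
    ultimately have "\<exists>w. ((1 - w) / (1 + w))\<^sup>2 < s \<and> w \<in> {0<..<v}"
      using eventually_conj eventually_happens' trivial_limit_at_left_real by blast
    then obtain w where w: "((1 - w) / (1 + w))\<^sup>2 < s" "0 < w" "w < v" by auto
    have "uniform_set b (\<lambda>n. n) v \<subseteq> {\<xi>. uniformly_approx b (\<lambda>n. n) w \<xi>}"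
      using b w(3) uniformly_approx_if_less_exponent[of b v "\<lambda>n. n"] by (auto simp: uniform_set_def)
    then show ?thesis
      using hausdorff_null_uniformly_approximable[OF b w(2) _ w(1)] w(3) v
      by (auto intro: hausdorff_null_subset)
  qed
qed simp

section \<open>Digit expansions\<close>

definition digit_value :: "nat \<Rightarrow> (nat \<Rightarrow> nat) \<Rightarrow> real" where
  "digit_value b D = (\<Sum>i. real (D i) / real b ^ Suc i)"

lemma sums_maximal_digits:
  assumes "b \<ge> 2"
  shows "(\<lambda>i. (real b - 1) / real b ^ Suc i) sums 1"
proof -
  have "(\<lambda>i. ((real b - 1) / real b) * (1 / real b) ^ i) sums ((real b - 1) / real b * (1 / (1 - 1 / real b)))"
    using assms by (intro sums_mult geometric_sums) auto
  moreover have "(real b - 1) / real b * (1 / (1 - 1 / real b)) = 1"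
    using assms by (simp add: field_simps)
  ultimately show ?thesis using assms by (simp add: power_divide)
qed

lemma summable_digits:
  assumes "b \<ge> 2" "\<And>i. D i < b"
  shows "summable (\<lambda>i. real (D i) / real b ^ Suc i)"
proof (rule summable_comparison_test'[OF sums_summable[OF sums_maximal_digits[OF assms(1)]]])
  fix i :: nat
  have "real (D i) \<le> real b - 1" using assms(2)[of i] by linarith
  then show "norm (real (D i) / real b ^ Suc i) \<le> (real b - 1) / real b ^ Suc i"
    using assms(1) by (simp add: divide_right_mono)
qed

lemma digit_value_nonneg:
  assumes "b \<ge> 2" "\<And>i. D i < b"
  shows "0 \<le> digit_value b D"
  unfolding digit_value_def by (intro suminf_nonneg summable_digits assms) auto

lemma digit_value_le_1:
  assumes "b \<ge> 2" "\<And>i. D i < b"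
  shows "digit_value b D \<le> 1"
proof -
  have "digit_value b D \<le> (\<Sum>i. (real b - 1) / real b ^ Suc i)"
    unfolding digit_value_def
  proof (rule suminf_le[OF _ summable_digits[of b D, OF assms] sums_summable[OF sums_maximal_digits[OF assms(1)]]])
    fix i
    have "real (D i) \<le> real b - 1" using assms(2)[of i] by linarith
    then show "real (D i) / real b ^ Suc i \<le> (real b - 1) / real b ^ Suc i"
      using assms(1) by (simp add: divide_right_mono)
  qed
  then show ?thesis using sums_unique[OF sums_maximal_digits[OF assms(1)]] by simp
qed

lemma digit_value_rec:
  assumes "b \<ge> 2" "\<And>i. D i < b"
  shows "digit_value b D = (real (D 0) + digit_value b (\<lambda>i. D (Suc i))) / real b"
proof -
  have "summable (\<lambda>i. real (D (Suc i)) / real b ^ Suc i)"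
    using assms by (intro summable_digits) auto
  from suminf_divide[OF this, of "real b"]
  have "(\<Sum>i. real (D (Suc i)) / real b ^ Suc (Suc i)) = digit_value b (\<lambda>i. D (Suc i)) / real b"
    unfolding digit_value_def by (simp add: mult.commute)
  then show ?thesis
    using suminf_split_head[OF summable_digits[of b D, OF assms]]
    unfolding digit_value_def[of b D] by (simp add: add_divide_distrib)
qed

lemma digit_value_shift:
  assumes "b \<ge> 2" "\<And>i. D i < b"
  shows "\<exists>m :: int. real b ^ n * digit_value b D = of_int m + digit_value b (\<lambda>i. D (i + n))"
proof (induction n)
  case (Suc n)
  then obtain m where m: "real b ^ n * digit_value b D = of_int m + digit_value b (\<lambda>i. D (i + n))" by blast
  have "real b ^ Suc n * digit_value b D = real b * of_int m + real b * digit_value b (\<lambda>i. D (i + n))"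
    using m by (simp add: algebra_simps)
  also have "real b * digit_value b (\<lambda>i. D (i + n)) = real (D n) + digit_value b (\<lambda>i. D (i + Suc n))"
    using digit_value_rec[of b "\<lambda>i. D (i + n)"] assms by simp
  finally show ?case by (intro exI[of _ "int b * m + int (D n)"]) simp
qed (auto intro: exI[of _ 0])

lemma digit_value_le_if_zeros:
  assumes "b \<ge> 2" "\<And>i. D i < b" "\<And>i. i < m \<Longrightarrow> D i = 0"
  shows "digit_value b D \<le> 1 / real b ^ m"
  using assms(2,3)
proof (induction m arbitrary: D)
  case 0
  then show ?case using digit_value_le_1[OF assms(1)] by simp
next
  case (Suc m)
  have "digit_value b (\<lambda>i. D (Suc i)) \<le> 1 / real b ^ m" using Suc.prems by (intro Suc.IH) auto
  then have "digit_value b (\<lambda>i. D (Suc i)) / real b \<le> 1 / real b ^ m / real b"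
    by (intro divide_right_mono) auto
  moreover have "digit_value b D = digit_value b (\<lambda>i. D (Suc i)) / real b"
    using digit_value_rec[of b D, OF assms(1) Suc.prems(1)] Suc.prems(2)[of 0] by simp
  ultimately show ?case by (simp add: mult.commute)
qed

lemma digit_value_ge_if_nonzero:
  assumes "b \<ge> 2" "\<And>i. D i < b" "D i \<noteq> 0"
  shows "1 / real b ^ Suc i \<le> digit_value b D"
  using assms(2,3)
proof (induction i arbitrary: D)
  case 0
  then show ?case
    unfolding digit_value_rec[of b D, OF assms(1) 0(1)]
    using digit_value_nonneg[OF assms(1), of "\<lambda>i. D (Suc i)"] 0 assms(1) by (simp add: divide_right_mono)
next
  case (Suc i)
  have "1 / real b ^ Suc i \<le> digit_value b (\<lambda>i. D (Suc i))" using Suc.prems by (intro Suc.IH) auto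
  then have "1 / real b ^ Suc i / real b \<le> (real (D 0) + digit_value b (\<lambda>i. D (Suc i))) / real b"
    by (intro divide_right_mono) auto
  then show ?case unfolding digit_value_rec[of b D, OF assms(1) Suc.prems(1)] by (simp add: mult.commute)
qed

text \<open>The trivial bound 1 is attained only by digits \<open>b - 1\<close> against digits 0
  throughout; a common digit at \<open>i\<close> lowers the maximum by
  \<open>(b - 1) / b ^ Suc i\<close>.\<close>

lemma digit_value_diff_le_if_common_digit:
  assumes "b \<ge> 2" "\<And>i. D i < b" "\<And>i. D' i < b" "D i = D' i"
  shows "digit_value b D - digit_value b D' \<le> 1 - 1 / real b ^ Suc i"
  using assms(2-)
proof (induction i arbitrary: D D')
  case 0
  have "digit_value b D - digit_value b D'
      = (digit_value b (\<lambda>i. D (Suc i)) - digit_value b (\<lambda>i. D' (Suc i))) / real b"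
    unfolding digit_value_rec[of b D, OF assms(1) 0(1)] digit_value_rec[of b D', OF assms(1) 0(2)]
    using 0(3) by (simp add: diff_divide_distrib add_divide_distrib)
  also have "\<dots> \<le> 1 / real b"
    using digit_value_le_1[of b "\<lambda>i. D (Suc i)"] digit_value_nonneg[of b "\<lambda>i. D' (Suc i)"] 0 assms(1)
    by (intro divide_right_mono) auto
  also have "\<dots> \<le> 1 - 1 / real b" using assms(1) by (simp add: field_simps)
  finally show ?case by simp
next
  case (Suc i)
  have IH: "digit_value b (\<lambda>i. D (Suc i)) - digit_value b (\<lambda>i. D' (Suc i)) \<le> 1 - 1 / real b ^ Suc i"
    using Suc.prems by (intro Suc.IH) auto
  have "D 0 \<le> b - 1" using Suc.prems(1)[of 0] by simp
  then have "real (D 0) - real (D' 0) \<le> real b - 1" using assms(1) by linarith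
  then have "(real (D 0) - real (D' 0) + (digit_value b (\<lambda>i. D (Suc i)) - digit_value b (\<lambda>i. D' (Suc i)))) / real b
      \<le> (real b - 1 / real b ^ Suc i) / real b"
    using IH by (intro divide_right_mono) auto
  also have "\<dots> = 1 - 1 / real b ^ Suc (Suc i)"
    using assms(1) by (simp add: field_simps)
  finally show ?case
    unfolding digit_value_rec[of b D, OF assms(1) Suc.prems(1)] digit_value_rec[of b D', OF assms(1) Suc.prems(2)]
    by (simp add: diff_divide_distrib[symmetric] algebra_simps)
qed

lemma digit_value_le_if_not_maximal:
  assumes "b \<ge> 2" "\<And>i. D i < b" "D i \<noteq> b - 1"
  shows "digit_value b D \<le> 1 - 1 / real b ^ Suc i"
  using assms(2,3)
proof (induction i arbitrary: D)
  case 0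
  have "D 0 \<le> b - 2" using 0(1)[of 0] 0(2) by simp
  then have "real (D 0) \<le> real b - 2" using assms(1) by linarith
  then have "(real (D 0) + digit_value b (\<lambda>i. D (Suc i))) / real b \<le> (real b - 1) / real b"
    using digit_value_le_1[of b "\<lambda>i. D (Suc i)"] 0 assms(1) by (intro divide_right_mono) auto
  also have "\<dots> = 1 - 1 / real b ^ Suc 0" using assms(1) by (simp add: field_simps)
  finally show ?case unfolding digit_value_rec[of b D, OF assms(1) 0(1)] .
next
  case (Suc i)
  have IH: "digit_value b (\<lambda>i. D (Suc i)) \<le> 1 - 1 / real b ^ Suc i"
    using Suc.prems by (intro Suc.IH) auto
  have "D 0 \<le> b - 1" using Suc.prems(1)[of 0] by simp
  then have "real (D 0) \<le> real b - 1" using assms(1) by linarith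
  then have "(real (D 0) + digit_value b (\<lambda>i. D (Suc i))) / real b \<le> (real b - 1 / real b ^ Suc i) / real b"
    using IH by (intro divide_right_mono) auto
  also have "\<dots> = 1 - 1 / real b ^ Suc (Suc i)" using assms(1) by (simp add: field_simps)
  finally show ?case unfolding digit_value_rec[of b D, OF assms(1) Suc.prems(1)] .
qed

text \<open>
  Without a common digit after the first difference, two expansions such as \<open>0.0111\<dots>\<close> and \<open>0.1000\<dots>\<close> could
  have the same value.
\<close>

lemma digit_value_separated:
  assumes "b \<ge> 2" "\<And>i. D i < b" "\<And>i. D' i < b"
    and "\<And>l. l < i \<Longrightarrow> D l = D' l" "D i \<noteq> D' i" "i < j" "D j = D' j"
  shows "1 / real b ^ Suc j \<le> \<bar>digit_value b D - digit_value b D'\<bar>"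
  using assms(2-)
proof (induction i arbitrary: D D' j)
  case 0
  \<comment> \<open>By symmetry \<open>E\<close> has the smaller leading digit. The leading digits
    gain at least 1, and because of the common digit the tails lose at most
    \<open>1 - 1 / b ^ j\<close>.\<close>
  have ineq: "1 / real b ^ Suc j \<le> digit_value b E' - digit_value b E"
    if E: "\<And>i. E i < b" "\<And>i. E' i < b" "E 0 < E' 0" "E j = E' j" for E E' :: "nat \<Rightarrow> nat"
  proof -
    obtain j' where j: "j = Suc j'" using 0 by (cases j) auto
    have "digit_value b (\<lambda>i. E (Suc i)) - digit_value b (\<lambda>i. E' (Suc i)) \<le> 1 - 1 / real b ^ Suc j'"
      using E j by (intro digit_value_diff_le_if_common_digit assms) auto
    moreover have "1 \<le> real (E' 0) - real (E 0)" using E(3) by linarith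
    ultimately have "1 / real b ^ j / real b \<le>
        (real (E' 0) - real (E 0) + (digit_value b (\<lambda>i. E' (Suc i)) - digit_value b (\<lambda>i. E (Suc i)))) / real b"
      by (intro divide_right_mono) (auto simp: j)
    then show ?thesis
      unfolding digit_value_rec[of b E, OF assms(1) E(1)] digit_value_rec[of b E', OF assms(1) E(2)]
      by (simp add: diff_divide_distrib[symmetric] algebra_simps)
  qed
  show ?case
  proof (cases "D 0 < D' 0")
    case True
    then show ?thesis using ineq[of D D'] 0 by fastforce
  next
    case False
    then show ?thesis using ineq[of D' D] 0 by fastforce
  qed
next
  case (Suc i)
  obtain j' where j: "j = Suc j'" using Suc.prems by (cases j) auto
  have "1 / real b ^ Suc j' \<le> \<bar>digit_value b (\<lambda>i. D (Suc i)) - digit_value b (\<lambda>i. D' (Suc i))\<bar>"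
    using Suc.prems j by (intro Suc.IH) auto
  then have "1 / real b ^ Suc j' / real b \<le> \<bar>digit_value b (\<lambda>i. D (Suc i)) - digit_value b (\<lambda>i. D' (Suc i))\<bar> / real b"
    by (intro divide_right_mono) auto
  also have "\<dots> = \<bar>digit_value b D - digit_value b D'\<bar>"
    unfolding digit_value_rec[of b D, OF assms(1) Suc.prems(1)] digit_value_rec[of b D', OF assms(1) Suc.prems(2)]
    using Suc.prems(3)[of 0] by (simp add: diff_divide_distrib[symmetric])
  finally show ?case by (simp add: j mult.commute)
qed

section \<open>Numbers read into the free positions of an expansion\<close>

definition nth_digit :: "nat \<Rightarrow> real \<Rightarrow> nat \<Rightarrow> nat" where
  "nth_digit b t j = nat (\<lfloor>t * real b ^ Suc j\<rfloor> mod int b)"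

lemma nth_digit_less: "b > 0 \<Longrightarrow> nth_digit b t j < b"
  by (simp add: nth_digit_def nat_less_iff)

text \<open>The first \<open>m\<close> digits determine the floor of \<open>t * b ^ m\<close>, so
  both points lie in the same \<open>b\<close>-adic interval of length
  \<open>1 / b ^ m\<close>.\<close>

lemma abs_diff_le_if_common_digits:
  assumes b: "b > 0" and t: "t \<in> {0..<1}" "t' \<in> {0..<1}"
    and eq: "\<And>j. j < m \<Longrightarrow> nth_digit b t j = nth_digit b t' j"
  shows "\<bar>t - t'\<bar> \<le> 1 / real b ^ m"
proof -
  have "\<lfloor>t * real b ^ m\<rfloor> = \<lfloor>t' * real b ^ m\<rfloor>"
    using eq
  proof (induction m)
    case 0
    have "\<lfloor>t\<rfloor> = 0" "\<lfloor>t'\<rfloor> = 0" using t by (auto simp: floor_eq_iff)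
    then show ?case by simp
  next
    case (Suc m)
    have split: "\<lfloor>x * real b ^ Suc m\<rfloor> = \<lfloor>x * real b ^ m\<rfloor> * int b + int (nth_digit b x m)" for x
    proof -
      have "\<lfloor>x * real b ^ m\<rfloor> = \<lfloor>x * real b ^ Suc m / real b\<rfloor>" using b by (simp add: field_simps)
      also have "\<dots> = \<lfloor>x * real b ^ Suc m\<rfloor> div int b" using floor_divide_real_eq_div[of "int b" "x * real b ^ Suc m"] by (simp del: power_Suc)
      finally have "\<lfloor>x * real b ^ m\<rfloor> = \<lfloor>x * real b ^ Suc m\<rfloor> div int b" .
      moreover have "int (nth_digit b x m) = \<lfloor>x * real b ^ Suc m\<rfloor> mod int b"
        using b by (simp add: nth_digit_def del: power_Suc)
      ultimately show ?thesis by (simp only: div_mult_mod_eq)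
    qed
    have "\<lfloor>t * real b ^ m\<rfloor> = \<lfloor>t' * real b ^ m\<rfloor>"
      by (rule Suc.IH) (rule Suc.prems, simp)
    moreover have "nth_digit b t m = nth_digit b t' m" by (rule Suc.prems) simp
    ultimately show ?case by (simp only: split)
  qed
  then have "\<bar>t * real b ^ m - t' * real b ^ m\<bar> \<le> 1" by linarith
  moreover have "t * real b ^ m - t' * real b ^ m = (t - t') * real b ^ m" by (simp add: algebra_simps)
  ultimately have "\<bar>t - t'\<bar> * real b ^ m \<le> 1" by (simp add: abs_mult)
  then show ?thesis using b by (simp add: pos_le_divide_eq)
qed

text \<open>Doubles as the index of the digit of \<open>t\<close> that is written at the free
  position \<open>i\<close>; by \<open>rank_surj\<close> no digit is skipped.\<close>

definition rank :: "(nat \<Rightarrow> bool) \<Rightarrow> nat \<Rightarrow> nat" where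
  "rank free i = card {j. j < i \<and> free j}"

lemma rank_0 [simp]: "rank free 0 = 0"
  by (simp add: rank_def)

lemma rank_Suc: "rank free (Suc i) = (if free i then Suc (rank free i) else rank free i)"
proof -
  have "{j. j < Suc i \<and> free j} = (if free i then insert i {j. j < i \<and> free j} else {j. j < i \<and> free j})"
    by (auto simp: less_Suc_eq)
  then show ?thesis by (simp add: rank_def)
qed

lemma rank_surj: "m < rank free i \<Longrightarrow> \<exists>j<i. free j \<and> rank free j = m"
  by (induction i) (auto simp: rank_Suc less_Suc_eq split: if_splits)

text \<open>Let two of the expansions first differ at \<open>i\<close>. Their arguments agree in
  \<open>rank free i\<close> digits and so are within a constant times
  \<open>b powr (- s * i)\<close>, whereas the values are at least
  \<open>1 / b ^ Suc (i + d)\<close> apart, because a prescribed digit follows within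
  \<open>d\<close> places. Together this is the inverse Hoelder condition.\<close>

lemma hausdorff_measure_digit_set_pos:
  assumes b: "b \<ge> 2" and c: "\<And>i. c i < b" and s: "0 \<le> s"
    and rank: "\<And>i. s * real i - C \<le> real (rank free i)"
    and unbounded: "\<And>m. \<exists>i. m \<le> rank free i"
    and fixed: "\<And>i. \<exists>j. i < j \<and> j \<le> i + d \<and> \<not> free j"
    and K: "\<And>D. (\<And>i. D i < b) \<Longrightarrow> (\<And>i. \<not> free i \<Longrightarrow> D i = c i) \<Longrightarrow> digit_value b D \<in> K"
  shows "hausdorff_measure s K \<noteq> 0"
proof (rule hausdorff_measure_pos_if_inverse_holder[OF s])
  define D where "D t i = (if free i then nth_digit b t (rank free i) else c i)" for t i
  have D: "D t i < b" for t i using b c by (simp add: D_def nth_digit_less)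
  show "(\<lambda>t. digit_value b (D t)) ` {0..<1} \<subseteq> K"
    using K[of "D _", OF D] by (auto simp: D_def)
  show "0 < real b powr (C + s * (real d + 1))" using b by simp
  fix t t' :: real assume t: "t \<in> {0..<1}" "t' \<in> {0..<1}" "t \<noteq> t'"
  have close: "\<bar>t - t'\<bar> \<le> 1 / real b ^ rank free i" if "\<And>l. l < i \<Longrightarrow> D t l = D t' l" for i
  proof (rule abs_diff_le_if_common_digits)
    fix j assume "j < rank free i"
    then obtain l where "l < i" "free l" "rank free l = j" using rank_surj by blast
    then show "nth_digit b t j = nth_digit b t' j" using that[of l] by (simp add: D_def)
  qed (use b t in auto)
  \<comment> \<open>As the rank is unbounded, every digit of \<open>t\<close> is used somewhere, so
    distinct arguments give distinct expansions.\<close>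
  have "\<exists>i. D t i \<noteq> D t' i"
  proof (rule ccontr)
    assume "\<not> ?thesis"
    then have le: "\<bar>t - t'\<bar> \<le> 1 / real b ^ rank free i" for i by (intro close) auto
    have "0 < \<bar>t - t'\<bar>" using t(3) by simp
    then obtain m where m: "(1 / real b) ^ m < \<bar>t - t'\<bar>"
      using real_arch_pow_inv[of "\<bar>t - t'\<bar>" "1 / real b"] b by auto
    obtain i where "m \<le> rank free i" using unbounded by blast
    then have "1 / real b ^ rank free i \<le> 1 / real b ^ m"
      using b by (intro divide_left_mono power_increasing) auto
    then show False using le[of i] m by (simp add: power_divide)
  qed
  then obtain i where i: "D t i \<noteq> D t' i" "\<And>l. l < i \<Longrightarrow> D t l = D t' l"
    using exists_least_iff[of "\<lambda>i. D t i \<noteq> D t' i"] by blast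
  obtain j where j: "i < j" "j \<le> i + d" "\<not> free j" using fixed by blast
  have "1 / real b ^ Suc (i + d) \<le> 1 / real b ^ Suc j"
    using b j(2) by (intro divide_left_mono power_increasing) auto
  also have "\<dots> \<le> dist (digit_value b (D t)) (digit_value b (D t'))"
    unfolding dist_real_def using i j by (intro digit_value_separated[of b "D t" "D t'" i, OF b D D]) (auto simp: D_def)
  finally have sep: "1 / real b ^ Suc (i + d) \<le> dist (digit_value b (D t)) (digit_value b (D t'))" .
  moreover have "0 < 1 / real b ^ Suc (i + d)" using b by simp
  ultimately have "digit_value b (D t) \<noteq> digit_value b (D t')" by auto
  have "\<bar>t - t'\<bar> \<le> 1 / real b ^ rank free i" by (intro close i(2))
  also have "\<dots> = real b powr (- real (rank free i))"
    using b by (simp add: powr_minus powr_realpow field_simps)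
  also have "\<dots> \<le> real b powr (C - s * real i)"
    using b rank[of i] by (intro powr_mono) auto
  also have "\<dots> = real b powr (C + s * (real d + 1)) * (1 / real b ^ Suc (i + d)) powr s"
  proof -
    have "1 / real b ^ Suc (i + d) = real b powr (- real (Suc (i + d)))"
      using b by (simp only: powr_minus powr_realpow) (simp add: field_simps)
    then have "(1 / real b ^ Suc (i + d)) powr s = real b powr (- real (Suc (i + d)) * s)"
      by (simp only: powr_powr)
    then show ?thesis by (simp add: powr_add[symmetric] algebra_simps)
  qed
  also have "\<dots> \<le> real b powr (C + s * (real d + 1)) * dist (digit_value b (D t)) (digit_value b (D t')) powr s"
    using sep s by (intro mult_left_mono powr_mono2) auto
  finally show "\<bar>t - t'\<bar> \<le> real b powr (C + s * (real d + 1)) * dist (digit_value b (D t)) (digit_value b (D t')) powr s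
      \<and> digit_value b (D t) \<noteq> digit_value b (D t')"
    using \<open>digit_value b (D t) \<noteq> digit_value b (D t')\<close> by blast
qed

section \<open>Lower bound\<close>

lemma nearest_int_dist_digit_value_le:
  assumes "b \<ge> 2" "\<And>i. D i < b" "\<And>i. i < m \<Longrightarrow> D (i + n) = 0"
  shows "nearest_int_dist (real b ^ n * digit_value b D) \<le> 1 / real b ^ m"
proof -
  obtain k where k: "real b ^ n * digit_value b D = of_int k + digit_value b (\<lambda>i. D (i + n))"
    using digit_value_shift[OF assms(1), of D] assms(2) by blast
  have "nearest_int_dist (real b ^ n * digit_value b D) \<le> digit_value b (\<lambda>i. D (i + n))"
    using nearest_int_dist_le[of "real b ^ n * digit_value b D" k] digit_value_nonneg[of b "\<lambda>i. D (i + n)"] assms(1,2)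
    by (simp add: k)
  also have "\<dots> \<le> 1 / real b ^ m"
    using assms by (intro digit_value_le_if_zeros) auto
  finally show ?thesis .
qed

text \<open>Among the next \<open>L\<close> digits, the nonzero one keeps the fractional part away
  from 0 and the one other than \<open>b - 1\<close> keeps it away from 1.\<close>

lemma nearest_int_dist_digit_value_ge:
  assumes "b \<ge> 2" "\<And>i. D i < b"
    and i: "n \<le> i" "i < n + L" "D i \<noteq> 0" and j: "n \<le> j" "j < n + L" "D j \<noteq> b - 1"
  shows "1 / real b ^ L \<le> nearest_int_dist (real b ^ n * digit_value b D)"
proof -
  obtain k where k: "real b ^ n * digit_value b D = of_int k + digit_value b (\<lambda>i. D (i + n))"
    using digit_value_shift[OF assms(1), of D] assms(2) by blast
  define y where "y = digit_value b (\<lambda>i. D (i + n))"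
  have mono: "1 / real b ^ L \<le> 1 / real b ^ Suc (l - n)" if "n \<le> l" "l < n + L" for l
    using assms(1) that by (intro divide_left_mono power_increasing) auto
  have "1 / real b ^ Suc (i - n) \<le> y"
    unfolding y_def using assms i by (intro digit_value_ge_if_nonzero) auto
  moreover have "y \<le> 1 - 1 / real b ^ Suc (j - n)"
    unfolding y_def using assms j by (intro digit_value_le_if_not_maximal) auto
  ultimately have y: "1 / real b ^ L \<le> y" "y \<le> 1 - 1 / real b ^ L"
    using mono[OF i(1,2)] mono[OF j(1,2)] by linarith+
  show ?thesis
  proof (rule nearest_int_dist_geI)
    fix m :: int
    have "\<bar>of_int k + y - of_int m\<bar> \<ge> 1 / real b ^ L"
    proof (cases "m \<le> k")
      case True
      then have "real_of_int m \<le> of_int k" by simp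
      then show ?thesis using y by linarith
    next
      case False
      then have "k + 1 \<le> m" by simp
      then have "real_of_int (k + 1) \<le> of_int m" by (simp only: of_int_le_iff)
      then show ?thesis using y by simp
    qed
    then show "1 / real b ^ L \<le> \<bar>real b ^ n * digit_value b D - of_int m\<bar>"
      by (simp only: k y_def)
  qed
qed

lemma ex_power_le_less:
  fixes r x :: real
  assumes "1 < r" "1 \<le> x"
  obtains k where "r ^ k \<le> x" "x < r ^ Suc k"
proof -
  obtain m where "x < r ^ m" using real_arch_pow[OF assms(1)] by blast
  then have "\<exists>m. x < r ^ m" by blast
  define m0 where "m0 = (LEAST m. x < r ^ m)"
  have m0: "x < r ^ m0" unfolding m0_def by (rule LeastI_ex) fact
  then have "m0 \<noteq> 0" using assms(2) by (cases m0) auto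
  then obtain k where k: "m0 = Suc k" by (cases m0) auto
  have "\<not> x < r ^ k" using not_less_Least[of k "\<lambda>m. x < r ^ m"] k by (simp add: m0_def)
  then show ?thesis using that[of k] m0 k by simp
qed

lemma finite_nat_real_less [simp]: "finite {j :: nat. real j < y \<and> P j}"
proof (rule finite_subset)
  show "{j :: nat. real j < y \<and> P j} \<subseteq> {..nat \<lceil>y\<rceil>}" by auto linarith
qed simp

lemma finite_nat_interval [simp]: "finite {j :: nat. x \<le> real j \<and> real j < y}"
  by (rule finite_subset[OF _ finite_nat_real_less[of y "\<lambda>_. True"]]) auto

lemma card_nat_interval_le:
  fixes x y :: real
  assumes "0 \<le> x" "x \<le> y"
  shows "real (card {j :: nat. x \<le> real j \<and> real j < y}) \<le> y - x + 1"
proof -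
  have "{j :: nat. x \<le> real j \<and> real j < y} \<subseteq> {nat \<lceil>x\<rceil>..<nat \<lceil>y\<rceil>}"
    using assms by auto linarith+
  then have "card {j :: nat. x \<le> real j \<and> real j < y} \<le> card {nat \<lceil>x\<rceil>..<nat \<lceil>y\<rceil>}"
    by (intro card_mono) auto
  then have "real (card {j :: nat. x \<le> real j \<and> real j < y}) \<le> real (nat \<lceil>y\<rceil> - nat \<lceil>x\<rceil>)" by simp
  also have "\<dots> = real (nat \<lceil>y\<rceil>) - real (nat \<lceil>x\<rceil>)"
    using assms by (intro of_nat_diff nat_mono ceiling_mono)
  also have "\<dots> \<le> y - x + 1" using assms by linarith
  finally show ?thesis .
qed

lemma card_residue_class_le:
  assumes "0 < d"
  shows "real (card {j. j < n \<and> j mod d = a}) \<le> real n / real d + 1"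
proof -
  have "card {j. j < n \<and> j mod d = a} \<le> card {..n div d}"
  proof (rule card_inj_on_le)
    show "inj_on (\<lambda>j. j div d) {j. j < n \<and> j mod d = a}"
      by (rule inj_onI) (metis (mono_tags, lifting) div_mult_mod_eq mem_Collect_eq)
    show "(\<lambda>j. j div d) ` {j. j < n \<and> j mod d = a} \<subseteq> {..n div d}"
      by (auto intro: div_le_mono)
  qed simp
  then have "real (card {j. j < n \<and> j mod d = a}) \<le> real (n div d) + 1" by simp
  also have "\<dots> \<le> real n / real d + 1" using of_nat_div_le_of_nat[of n d] by simp
  finally show ?thesis .
qed

text \<open>Counting positions in blocks loses one unit per block. As \<open>r \<ge> 2\<close>,
  there are only logarithmically many blocks below \<open>n\<close>, which this bound makes an
  arbitrarily small proportion of \<open>n\<close>.\<close>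

lemma index_le_linear:
  assumes "0 < \<epsilon>"
  obtains C where "\<And>k. real k \<le> \<epsilon> * 2 ^ k + C"
proof -
  have "\<forall>\<^sub>F k in sequentially. real k \<le> \<epsilon> * 2 ^ k" using assms by real_asymp
  then obtain k0 where k0: "\<And>k. k0 \<le> k \<Longrightarrow> real k \<le> \<epsilon> * 2 ^ k"
    unfolding eventually_sequentially by blast
  have "real k \<le> \<epsilon> * 2 ^ k + real k0" for k
  proof (cases "k0 \<le> k")
    case True
    then show ?thesis using k0[of k] by simp
  next
    case False
    moreover have "0 \<le> \<epsilon> * 2 ^ k" using assms by simp
    ultimately show ?thesis by linarith
  qed
  then show ?thesis using that by blast
qed

text \<open>
  The ratio \<open>r = 2 / (1 - v)\<close> is the double root of the equation that governs the upper bound for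
  \<open>s = ((1 - v) / (1 + v))\<^sup>2\<close>, that is, the optimal growth rate of the record times. Outside the blocks of zeros
  the digits \<open>1\<close> and \<open>0\<close> are prescribed at two residues modulo \<open>d\<close>, which excludes other long runs of equal
  digits at the cost of a proportion \<open>2 / d\<close> of the free digits. Blocks start at \<open>r ^ d\<close> so that the gaps between
  them have length at least \<open>d\<close>. Digit \<open>i\<close> has weight \<open>b\<close> to the power \<open>-(i + 1)\<close>.
\<close>

locale block_construction =
  fixes b :: nat and v :: real and d :: nat
  assumes b: "b \<ge> 2" and v: "0 \<le> v" "v < 1" and d: "3 \<le> d"
begin

definition r :: real where "r = 2 / (1 - v)"

text \<open>The factor is \<open>r - 1\<close>. Thus the block has length
  \<open>v * r ^ Suc k\<close>, as exponent \<open>v\<close> requires for all \<open>N\<close> up to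
  the next block start, and the gap behind it has length \<open>r ^ k\<close>.\<close>

definition block_end :: "nat \<Rightarrow> real" where "block_end k = r ^ k * ((1 + v) / (1 - v))"

definition zero_position :: "nat \<Rightarrow> bool" where
  "zero_position i \<longleftrightarrow> (\<exists>k\<ge>d. r ^ k \<le> real i \<and> real i < block_end k)"

definition free_position :: "nat \<Rightarrow> bool" where
  "free_position i \<longleftrightarrow> \<not> zero_position i \<and> i mod d \<noteq> 0 \<and> i mod d \<noteq> 1"

text \<open>Outside the blocks both values are wanted: 1 is nonzero but is the maximal digit for
  \<open>b = 2\<close>, and 0 is never maximal.\<close>

definition fixed_digit :: "nat \<Rightarrow> nat" where
  "fixed_digit i = (if \<not> zero_position i \<and> i mod d = 0 then 1 else 0)"

lemma r_ge: "2 \<le> r"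
  unfolding r_def using v by (simp add: field_simps)

lemma block_end_minus: "block_end k - r ^ k = v * r ^ Suc k"
  unfolding block_end_def r_def using v by (simp add: field_simps)

lemma r_minus_e: "r ^ Suc k - block_end k = r ^ k"
proof -
  have "r - (1 + v) / (1 - v) = 1" unfolding r_def using v by (simp add: diff_divide_distrib[symmetric])
  moreover have "r ^ Suc k - block_end k = r ^ k * (r - (1 + v) / (1 - v))"
    unfolding block_end_def by (simp add: algebra_simps)
  ultimately show ?thesis by simp
qed

lemma r_pow_pos: "0 < r ^ k"
  using r_ge by simp

lemma r_pow_le_e: "r ^ k \<le> block_end k"
  using block_end_minus[of k] v r_pow_pos[of "Suc k"] by (smt (verit) mult_nonneg_nonneg)

lemma block_end_le: "block_end k \<le> r ^ Suc k"
  using r_minus_e[of k] r_pow_pos[of k] by simp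

lemma r_pow_mono: "j \<le> k \<Longrightarrow> r ^ j \<le> r ^ k"
  using r_ge by (intro power_increasing) auto

lemma block_index_eq:
  assumes "r ^ k \<le> x" "x < r ^ Suc k" "r ^ k' \<le> x" "x < block_end k'"
  shows "k' = k"
proof (rule ccontr)
  assume "k' \<noteq> k"
  then consider "Suc k' \<le> k" | "Suc k \<le> k'" by linarith
  then show False
  proof cases
    case 1
    then show ?thesis using r_pow_mono[OF 1] block_end_le[of k'] assms by linarith
  next
    case 2
    then show ?thesis using r_pow_mono[OF 2] assms by linarith
  qed
qed

lemma zero_in_block:
  assumes "zero_position i" "r ^ k \<le> real i" "real i < r ^ Suc k"
  shows "real i < block_end k"
proof -
  obtain k' where k': "r ^ k' \<le> real i" "real i < block_end k'" using assms(1) unfolding zero_position_def by blast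
  then have "k' = k" using block_index_eq[OF assms(2,3)] by blast
  then show ?thesis using k'(2) by simp
qed

text \<open>The density \<open>x = 2 * v / (1 + v)\<close> solves \<open>x + v * r = r * x\<close>,
  so it reproduces itself from one block start to the next. The summand \<open>k\<close> collects
  the rounding.\<close>

lemma card_zero_le:
  "real (card {j. real j < r ^ k \<and> zero_position j}) \<le> r ^ k * (2 * v / (1 + v)) + real k"
proof (induction k)
  case 0
  have "\<not> zero_position j" if "real j < 1" for j
    using that r_ge by (auto simp: zero_position_def not_le intro: order_less_le_trans one_le_power)
  then have "{j. real j < r ^ 0 \<and> zero_position j} = {}" by auto
  then show ?case using v by (simp only: card.empty) simp
next
  case (Suc k)
  have "{j. real j < r ^ Suc k \<and> zero_position j}
      \<subseteq> {j. real j < r ^ k \<and> zero_position j} \<union> {j. r ^ k \<le> real j \<and> real j < block_end k}"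
  proof
    fix j assume "j \<in> {j. real j < r ^ Suc k \<and> zero_position j}"
    then show "j \<in> {j. real j < r ^ k \<and> zero_position j} \<union> {j. r ^ k \<le> real j \<and> real j < block_end k}"
      using zero_in_block[of j k] by (cases "real j < r ^ k") auto
  qed
  then have "card {j. real j < r ^ Suc k \<and> zero_position j}
      \<le> card ({j. real j < r ^ k \<and> zero_position j} \<union> {j. r ^ k \<le> real j \<and> real j < block_end k})"
    by (intro card_mono finite_UnI finite_nat_real_less finite_nat_interval)
  also have "\<dots> \<le> card {j. real j < r ^ k \<and> zero_position j} + card {j. r ^ k \<le> real j \<and> real j < block_end k}"
    by (rule card_Un_le)
  finally have "real (card {j. real j < r ^ Suc k \<and> zero_position j})
      \<le> (r ^ k * (2 * v / (1 + v)) + real k) + (block_end k - r ^ k + 1)"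
    using Suc card_nat_interval_le[of "r ^ k" "block_end k"] r_pow_le_e[of k] r_pow_pos[of k] by linarith
  also have "\<dots> = r ^ k * (2 * v / (1 + v) + v * r) + real (Suc k)"
    unfolding block_end_minus by (simp add: algebra_simps)
  also have "2 * v / (1 + v) + v * r = r * (2 * v / (1 + v))"
  proof -
    have "1 - v \<noteq> 0" "1 + v \<noteq> 0" using v by auto
    then show ?thesis unfolding r_def by (simp add: divide_simps) (simp add: algebra_simps)
  qed
  finally have "real (card {j. real j < r ^ Suc k \<and> zero_position j}) \<le> r ^ k * (r * (2 * v / (1 + v))) + real (Suc k)" .
  also have "\<dots> = r ^ Suc k * (2 * v / (1 + v)) + real (Suc k)" by simp
  finally show ?case .
qed

text \<open>Equality holds at \<open>x = block_end k\<close>, where the proportion of positions in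
  blocks is largest; beyond it the proportion falls again.\<close>

lemma density_bound:
  assumes "r ^ k \<le> x"
  shows "r ^ k * (2 * v / (1 + v)) + (min x (block_end k) - r ^ k) \<le> (1 - ((1 - v) / (1 + v))\<^sup>2) * x"
proof -
  let ?q = "(1 - v) / (1 + v)"
  have q: "0 < ?q" "?q \<le> 1" using v by auto
  have eq: "r ^ k * (2 * v / (1 + v)) - r ^ k = - (?q * r ^ k)"
    using v by (simp add: field_simps)
  have ek: "r ^ k = ?q * block_end k" unfolding block_end_def using v by simp
  have q2: "?q\<^sup>2 \<le> 1" using q by (simp add: power_le_one)
  have "min x (block_end k) * (1 - ?q\<^sup>2) \<le> x * (1 - ?q\<^sup>2)" using q2 by (intro mult_right_mono) auto
  moreover have "?q\<^sup>2 * min x (block_end k) \<le> ?q\<^sup>2 * block_end k" by (intro mult_left_mono) auto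
  moreover have "?q * r ^ k = ?q\<^sup>2 * block_end k" unfolding ek by (simp add: power2_eq_square)
  ultimately show ?thesis using eq by (simp add: algebra_simps)
qed

lemma card_zero_less_le:
  assumes "r ^ k \<le> real n" "real n < r ^ Suc k"
  shows "real (card {j. j < n \<and> zero_position j}) \<le> (1 - ((1 - v) / (1 + v))\<^sup>2) * real n + real k + 1"
proof -
  have "{j. j < n \<and> zero_position j} \<subseteq> {j. real j < r ^ k \<and> zero_position j} \<union> {j. r ^ k \<le> real j \<and> real j < min (real n) (block_end k)}"
  proof
    fix j assume j: "j \<in> {j. j < n \<and> zero_position j}"
    then have "real j < r ^ Suc k" using assms(2) by (simp del: power_Suc)
    then show "j \<in> {j. real j < r ^ k \<and> zero_position j} \<union> {j. r ^ k \<le> real j \<and> real j < min (real n) (block_end k)}"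
      using j zero_in_block[of j k] by (cases "real j < r ^ k") auto
  qed
  then have "card {j. j < n \<and> zero_position j}
      \<le> card ({j. real j < r ^ k \<and> zero_position j} \<union> {j. r ^ k \<le> real j \<and> real j < min (real n) (block_end k)})"
    by (intro card_mono finite_UnI finite_nat_real_less finite_nat_interval)
  also have "\<dots> \<le> card {j. real j < r ^ k \<and> zero_position j} + card {j. r ^ k \<le> real j \<and> real j < min (real n) (block_end k)}"
    by (rule card_Un_le)
  finally have "real (card {j. j < n \<and> zero_position j})
      \<le> (r ^ k * (2 * v / (1 + v)) + real k) + (min (real n) (block_end k) - r ^ k + 1)"
    using card_zero_le[of k] card_nat_interval_le[of "r ^ k" "min (real n) (block_end k)"] assms(1) r_pow_le_e[of k] r_pow_pos[of k]
    by linarith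
  then show ?thesis using density_bound[OF assms(1)] by linarith
qed

lemma rank_free_ge:
  "real n - real (card {j. j < n \<and> zero_position j}) - 2 * real n / real d - 2 \<le> real (rank free_position n)"
proof -
  have "{..<n} \<subseteq> {j. j < n \<and> free_position j} \<union> ({j. j < n \<and> zero_position j} \<union> ({j. j < n \<and> j mod d = 0} \<union> {j. j < n \<and> j mod d = 1}))"
    by (auto simp: free_position_def)
  then have "card {..<n} \<le> card ({j. j < n \<and> free_position j} \<union> ({j. j < n \<and> zero_position j} \<union> ({j. j < n \<and> j mod d = 0} \<union> {j. j < n \<and> j mod d = 1})))"
    by (intro card_mono) auto
  also have "\<dots> \<le> card {j. j < n \<and> free_position j} + (card {j. j < n \<and> zero_position j} + (card {j. j < n \<and> j mod d = 0} + card {j. j < n \<and> j mod d = 1}))"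
    by (intro order_trans[OF card_Un_le] add_left_mono) auto
  finally have "real n \<le> real (rank free_position n) + (real (card {j. j < n \<and> zero_position j}) +
      (real (card {j. j < n \<and> j mod d = 0}) + real (card {j. j < n \<and> j mod d = 1})))"
    unfolding rank_def by simp
  then show ?thesis
    using card_residue_class_le[of d n 0] card_residue_class_le[of d n 1] d by simp
qed

lemma rank_free_linear:
  assumes "0 < \<epsilon>"
  obtains C where "\<And>n. (((1 - v) / (1 + v))\<^sup>2 - 2 / real d - \<epsilon>) * real n - C \<le> real (rank free_position n)"
proof -
  obtain C0 where C0: "\<And>k. real k \<le> \<epsilon> * 2 ^ k + C0" using index_le_linear[OF assms] by blast
  have "(((1 - v) / (1 + v))\<^sup>2 - 2 / real d - \<epsilon>) * real n - (\<bar>C0\<bar> + 3) \<le> real (rank free_position n)" for n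
  proof (cases "n = 0")
    case False
    then have "1 \<le> real n" by simp
    then obtain k where k: "r ^ k \<le> real n" "real n < r ^ Suc k"
      using ex_power_le_less[of r "real n"] r_ge by auto
    have "(2::real) ^ k \<le> r ^ k" using r_ge by (intro power_mono) auto
    then have "2 ^ k \<le> real n" using k(1) by linarith
    then have "\<epsilon> * 2 ^ k \<le> \<epsilon> * real n" using assms by (intro mult_left_mono) auto
    then have "real k \<le> \<epsilon> * real n + C0" using C0[of k] by linarith
    then show ?thesis
      using rank_free_ge[of n] card_zero_less_le[OF k] by (simp add: algebra_simps)
  qed simp
  then show ?thesis using that by blast
qed

lemma exists_fixed_position: "\<exists>j. i < j \<and> j \<le> i + d \<and> \<not> free_position j"
proof (intro exI conjI)
  show "i < d * (i div d + 1)" using d dividend_less_times_div[of d i] by simp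
  show "d * (i div d + 1) \<le> i + d" by simp
  show "\<not> free_position (d * (i div d + 1))" unfolding free_position_def by simp
qed

text \<open>For \<open>N\<close> from \<open>r ^ k\<close> up to \<open>r ^ Suc k\<close> the start
  of block \<open>k\<close> serves as \<open>n\<close>: up to rounding it is followed by
  \<open>v * r ^ Suc k\<close> zeros, which is at least \<open>v * N\<close>.\<close>

lemma uniformly_approx_digit_value:
  assumes D: "\<And>i. D i < b" "\<And>i. zero_position i \<Longrightarrow> D i = 0" and u: "0 \<le> u" "u < v"
  shows "uniformly_approx b (\<lambda>n. n) u (digit_value b D)"
proof -
  \<comment> \<open>The bound \<open>r ^ d\<close> ensures \<open>d \<le> k\<close>, so that block
    \<open>k\<close> is really used; \<open>1 / (v - u)\<close> pays for rounding the block start to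
    an integer.\<close>
  obtain N0 where N0: "r ^ d \<le> real N0" "1 / (v - u) < real N0" "1 \<le> N0"
  proof -
    obtain N0 where "max (r ^ d) (max (1 / (v - u)) 1) < real N0" using reals_Archimedean2 by blast
    then show ?thesis using that[of N0] by auto
  qed
  show ?thesis
    unfolding uniformly_approx_def eventually_sequentially
  proof (intro exI allI impI)
    fix N assume N: "N0 \<le> N"
    then have N': "r ^ d \<le> real N" "1 / (v - u) < real N" "1 \<le> real N" using N0 by auto
    obtain k where k: "r ^ k \<le> real N" "real N < r ^ Suc k"
      using ex_power_le_less[of r "real N"] r_ge N'(3) by auto
    have "d \<le> k"
    proof (rule ccontr)
      assume "\<not> d \<le> k"
      then have "r ^ Suc k \<le> r ^ d" by (intro r_pow_mono) auto
      then show False using k(2) N'(1) by linarith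
    qed
    define n where "n = nat \<lceil>r ^ k\<rceil>"
    define m where "m = nat \<lceil>block_end k\<rceil> - n"
    have n: "r ^ k \<le> real n" "real n < r ^ k + 1" "n \<le> N"
      unfolding n_def using k(1) r_pow_pos[of k] by linarith+
    have "1 \<le> n" using n(1) r_pow_pos[of k] by (cases n) auto
    have "real m \<ge> block_end k - real n" unfolding m_def by linarith
    then have "real m \<ge> v * r ^ Suc k - 1" using n(2) block_end_minus[of k] by linarith
    moreover have "v * real N \<le> v * r ^ Suc k" using k(2) v by (intro mult_left_mono) auto
    moreover have "1 < (v - u) * real N" using N'(2) u by (simp add: field_simps)
    ultimately have um: "u * real N < real m" by (simp add: algebra_simps)
    have "D (i + n) = 0" if "i < m" for i
    proof -
      have "real (i + n) < block_end k" using that unfolding m_def by linarith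
      then have "zero_position (i + n)" using \<open>d \<le> k\<close> n(1) unfolding zero_position_def by (intro exI[of _ k]) auto
      then show ?thesis by (rule D(2))
    qed
    then have "nearest_int_dist (real b ^ n * digit_value b D) \<le> 1 / real b ^ m"
      by (rule nearest_int_dist_digit_value_le[of b D m n, OF b D(1)])
    also have "\<dots> = real b powr (- real m)" using b by (simp add: powr_minus powr_realpow field_simps)
    also have "\<dots> < real b powr (- u * real N)" using b um by (intro powr_less_mono) auto
    finally show "\<exists>n\<in>{1..N}. nearest_int_dist (real b ^ n * digit_value b D) < real b powr (- u * real N)"
      using \<open>1 \<le> n\<close> n(3) by auto
  qed
qed

text \<open>If the \<open>d\<close> positions from \<open>n\<close> on meet a block, the window is
  placed right behind it. That block starts before \<open>r ^ Suc k\<close>, hence its length is at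
  most \<open>v * r ^ Suc k\<close>.\<close>

lemma exists_nonzero_window:
  assumes "real (n + d) \<le> r ^ Suc k"
  shows "\<exists>q\<ge>n. (\<forall>i\<in>{q..<q + d}. \<not> zero_position i) \<and> real (q + d) \<le> real n + v * r ^ Suc k + 2 * real d + 1"
proof (cases "\<exists>i\<in>{n..<n + d}. zero_position i")
  case False
  moreover have "0 \<le> v * r ^ Suc k" using v r_pow_pos[of "Suc k"] by (intro mult_nonneg_nonneg) auto
  ultimately show ?thesis by (intro exI[of _ n]) auto
next
  case True
  then obtain i j where i: "n \<le> i" "i < n + d" and j: "d \<le> j" "r ^ j \<le> real i" "real i < block_end j"
    unfolding zero_position_def by auto
  have "j \<le> k"
  proof (rule ccontr)
    assume "\<not> j \<le> k"
    then have "r ^ Suc k \<le> r ^ j" by (intro r_pow_mono) auto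
    moreover have "real i < real (n + d)" using i(2) by simp
    ultimately show False using j(2) assms by linarith
  qed
  define q where "q = nat \<lceil>block_end j\<rceil>"
  have q: "block_end j \<le> real q" "real q < block_end j + 1"
    unfolding q_def using j(3) by linarith+
  have "n \<le> q" using q(1) j(3) i(1) by linarith
  moreover have "\<not> zero_position l" if l: "l \<in> {q..<q + d}" for l
  proof
    assume "zero_position l"
    \<comment> \<open>The gap behind block \<open>j\<close> has length \<open>r ^ j\<close>; it must
      hold the window and the rounding up in \<open>q\<close>.\<close>
    have "real d + 1 \<le> r ^ j"
    proof -
      have "Suc d \<le> 2 ^ d" by (induction d) auto
      then have "real (Suc d) \<le> 2 ^ d" by (metis of_nat_le_iff of_nat_numeral of_nat_power)
      also have "\<dots> \<le> r ^ d" using r_ge by (intro power_mono) auto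
      also have "\<dots> \<le> r ^ j" using j(1) by (rule r_pow_mono)
      finally show ?thesis by simp
    qed
    moreover have "real q \<le> real l" "real l < real q + real d" using l by auto
    ultimately have "real l < r ^ Suc j" using q(2) r_minus_e[of j] by linarith
    moreover have "r ^ j \<le> real l" using r_pow_le_e[of j] q(1) \<open>real q \<le> real l\<close> by linarith
    ultimately have "real l < block_end j" using zero_in_block[OF \<open>zero_position l\<close>] by blast
    then show False using q(1) \<open>real q \<le> real l\<close> by linarith
  qed
  moreover have "real (q + d) \<le> real n + v * r ^ Suc k + 2 * real d + 1"
  proof -
    have "v * r ^ Suc j \<le> v * r ^ Suc k" using v \<open>j \<le> k\<close> by (intro mult_left_mono r_pow_mono) auto
    moreover have "r ^ j \<le> real n + real d" using j(2) i(2) by linarith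
    ultimately show ?thesis using q(2) block_end_minus[of j] by simp
  qed
  ultimately show ?thesis by blast
qed

lemma exists_residue_in_window:
  assumes "a < d"
  shows "\<exists>i\<in>{q..<q + d}. i mod d = a"
proof -
  define s where "s = (a + (d - q mod d)) mod d"
  have "q mod d < d" using d by simp
  have "(q + s) mod d = (q mod d + (a + (d - q mod d))) mod d"
    unfolding s_def by (simp add: mod_simps)
  also have "q mod d + (a + (d - q mod d)) = a + d" using \<open>q mod d < d\<close> by simp
  also have "(a + d) mod d = a" using assms by simp
  finally have "(q + s) mod d = a" .
  moreover have "s < d" using d by (simp add: s_def)
  ultimately show ?thesis by (intro bexI[of _ "q + s"]) auto
qed

text \<open>The critical \<open>N\<close> lie just before a block start \<open>R\<close>. From any
  \<open>n \<le> N\<close> on, a 1 and a 0 occur within about \<open>v * R\<close> digits, so no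
  distance is much below \<open>b powr (- v * R)\<close>, and this is too large for
  \<open>u > v\<close>.\<close>

lemma not_uniformly_approx_digit_value:
  assumes D: "\<And>i. D i < b" "\<And>i. \<not> free_position i \<Longrightarrow> D i = fixed_digit i" and u: "v < u"
  shows "\<not> uniformly_approx b (\<lambda>n. n) u (digit_value b D)"
proof
  assume "uniformly_approx b (\<lambda>n. n) u (digit_value b D)"
  then obtain N0 where N0: "\<And>N. N0 \<le> N \<Longrightarrow>
      \<exists>n\<in>{1..N}. nearest_int_dist (real b ^ n * digit_value b D) < real b powr (- u * real N)"
    unfolding uniformly_approx_def eventually_sequentially by blast
  define X where "X = max ((2 * real d + 2 + u * (real d + 1)) / (u - v)) (real N0 + real d + 1)"
  obtain k where k: "X < r ^ k"
    using real_arch_pow[of r X] r_ge by auto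
  define R where "R = r ^ Suc k"
  have "r ^ k \<le> R" unfolding R_def by (intro r_pow_mono) auto
  then have R: "2 * real d + 2 + u * (real d + 1) < (u - v) * R" "real N0 + real d + 1 < R"
  proof -
    have "(2 * real d + 2 + u * (real d + 1)) / (u - v) < R" "real N0 + real d + 1 < R"
      using k \<open>r ^ k \<le> R\<close> unfolding X_def by linarith+
    then show "2 * real d + 2 + u * (real d + 1) < (u - v) * R" "real N0 + real d + 1 < R"
      using u by (simp_all add: pos_divide_less_eq mult.commute)
  qed
  \<comment> \<open>Subtracting \<open>d\<close> keeps the \<open>d\<close> positions from any
    \<open>n \<le> N\<close> on below \<open>R\<close>, as \<open>exists_nonzero_window\<close>
    demands.\<close>
  define N where "N = nat \<lfloor>R\<rfloor> - d"
  have N: "real N + real d \<le> R" "R - 1 - real d < real N" "N0 \<le> N"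
    unfolding N_def using R(2) by linarith+
  obtain n where n: "n \<in> {1..N}" "nearest_int_dist (real b ^ n * digit_value b D) < real b powr (- u * real N)"
    using N0[OF N(3)] by blast
  have "real (n + d) \<le> r ^ Suc k" using n(1) N(1) unfolding R_def by auto
  then obtain q where q: "n \<le> q" "\<And>i. i \<in> {q..<q + d} \<Longrightarrow> \<not> zero_position i"
    "real (q + d) \<le> real n + v * R + 2 * real d + 1"
    using exists_nonzero_window unfolding R_def by blast
  define L where "L = q + d - n"
  obtain i where i: "i \<in> {q..<q + d}" "i mod d = 0" using exists_residue_in_window[of 0 q] d by auto
  obtain j where j: "j \<in> {q..<q + d}" "j mod d = 1" using exists_residue_in_window[of 1 q] d by auto
  have "D i = 1" using i q(2)[of i] D(2)[of i] by (simp add: free_position_def fixed_digit_def)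
  moreover have "D j = 0" using j q(2)[of j] D(2)[of j] by (simp add: free_position_def fixed_digit_def)
  ultimately have "1 / real b ^ L \<le> nearest_int_dist (real b ^ n * digit_value b D)"
    using i j q(1) b by (intro nearest_int_dist_digit_value_ge[of b D n i L j, OF b D(1)]) (auto simp: L_def)
  moreover have "real b powr (- u * real N) \<le> 1 / real b ^ L"
  proof -
    have "real L \<le> v * R + 2 * real d + 1" using q(1,3) by (simp add: L_def of_nat_diff)
    also have "\<dots> \<le> u * (R - 1 - real d)" using R(1) by (simp add: algebra_simps)
    also have "\<dots> \<le> u * real N" using N(2) u v by (intro mult_left_mono) auto
    finally have "real b powr (- u * real N) \<le> real b powr (- real L)"
      using b by (intro powr_mono) auto
    also have "\<dots> = 1 / real b ^ L" using b by (simp add: powr_minus powr_realpow field_simps)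
    finally show ?thesis .
  qed
  ultimately show False using n(2) by linarith
qed

lemma digit_value_in_uniform_set_exact:
  assumes "\<And>i. D i < b" "\<And>i. \<not> free_position i \<Longrightarrow> D i = fixed_digit i"
  shows "digit_value b D \<in> uniform_set_exact b (\<lambda>n. n) v"
proof -
  have zero_position: "D i = 0" if "zero_position i" for i
    using assms(2)[of i] that by (simp add: free_position_def fixed_digit_def)
  have "ereal v \<le> uniform_exponent b (\<lambda>n. n) (digit_value b D)"
    using b v by (intro uniform_exponent_geI uniformly_approx_digit_value assms(1) zero_position) auto
  moreover have "uniform_exponent b (\<lambda>n. n) (digit_value b D) \<le> ereal v"
    using b by (intro uniform_exponent_leI not_uniformly_approx_digit_value assms) auto
  ultimately show ?thesis unfolding uniform_set_exact_def by simp
qed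

lemma hausdorff_measure_uniform_set_exact_pos:
  assumes "0 \<le> s" "s < ((1 - v) / (1 + v))\<^sup>2 - 2 / real d"
  shows "hausdorff_measure s (uniform_set_exact b (\<lambda>n. n) v) \<noteq> 0"
proof -
  \<comment> \<open>Only half of the gap is given away, so the rank grows with slope
    \<open>s + \<epsilon>\<close>, which is positive even for \<open>s = 0\<close>; this makes the
    rank unbounded.\<close>
  define \<epsilon> where "\<epsilon> = (((1 - v) / (1 + v))\<^sup>2 - 2 / real d - s) / 2"
  have \<epsilon>: "0 < \<epsilon>" using assms(2) by (simp add: \<epsilon>_def)
  obtain C where "\<And>n. (((1 - v) / (1 + v))\<^sup>2 - 2 / real d - \<epsilon>) * real n - C \<le> real (rank free_position n)"
    using rank_free_linear[OF \<epsilon>] by blast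
  then have C: "(s + \<epsilon>) * real n - C \<le> real (rank free_position n)" for n
    by (simp add: \<epsilon>_def field_simps)
  show ?thesis
  proof (rule hausdorff_measure_digit_set_pos[OF b _ assms(1) _ _ exists_fixed_position])
    show "fixed_digit i < b" for i using b by (simp add: fixed_digit_def)
    show "s * real i - C \<le> real (rank free_position i)" for i
      using C[of i] \<epsilon> by (simp add: algebra_simps) (smt (verit) mult_nonneg_nonneg of_nat_0_le_iff)
    show "\<exists>i. m \<le> rank free_position i" for m
    proof -
      obtain i where "(real m + C) / (s + \<epsilon>) < real i" using reals_Archimedean2 by blast
      then have "real m < (s + \<epsilon>) * real i - C" using assms(1) \<epsilon> by (simp add: field_simps)
      then show ?thesis using C[of i] by (intro exI[of _ i]) linarith
    qed
    show "digit_value b D \<in> uniform_set_exact b (\<lambda>n. n) v"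
      if "\<And>i. D i < b" "\<And>i. \<not> free_position i \<Longrightarrow> D i = fixed_digit i" for D
      using that by (rule digit_value_in_uniform_set_exact)
  qed
qed

end

lemma hausdorff_dim_uniform_set_exact_id_ge:
  assumes b: "b \<ge> 2" and v: "0 \<le> v" "v \<le> 1"
  shows "ereal (((1 - v) / (1 + v))\<^sup>2) \<le> hausdorff_dim (uniform_set_exact b (\<lambda>n. n) v)"
proof (rule hausdorff_dim_ge)
  fix s assume s: "0 \<le> s" "s < ((1 - v) / (1 + v))\<^sup>2"
  have "v \<noteq> 1" using s by auto
  \<comment> \<open>The prescribed residues cost a proportion \<open>2 / d\<close>, which must stay
    below the gap to \<open>s\<close>; the added 3 secures \<open>3 \<le> d\<close>.\<close>
  obtain d where d: "2 / (((1 - v) / (1 + v))\<^sup>2 - s) + 3 < real d" using reals_Archimedean2 by blast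
  have "0 < 2 / (((1 - v) / (1 + v))\<^sup>2 - s)" using s by simp
  then have "3 \<le> d" using d by linarith
  have "2 / (((1 - v) / (1 + v))\<^sup>2 - s) < real d" using d by linarith
  then have less: "2 / real d < ((1 - v) / (1 + v))\<^sup>2 - s"
    using s \<open>3 \<le> d\<close> by (subst pos_divide_less_eq) (auto simp: pos_divide_less_eq mult.commute)
  interpret block_construction b v d
    using b v \<open>v \<noteq> 1\<close> \<open>3 \<le> d\<close> by unfold_locales auto
  show "hausdorff_measure s (uniform_set_exact b (\<lambda>n. n) v) \<noteq> 0"
    using s less by (intro hausdorff_measure_uniform_set_exact_pos) auto
qed

theorem theorem1p1:
  fixes b :: nat and a :: "nat \<Rightarrow> nat" and \<eta> :: ereal and v :: real
  assumes "b \<ge> 2"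
    and "strict_mono_on {1..} a"
    and "\<And>n. n \<ge> 1 \<Longrightarrow> a n > 0"
    and "\<eta> = limsup (\<lambda>n. ereal (real (a (Suc n)) / real (a n)))"
    and "\<eta> < \<infinity>"
    and "\<eta> = 1"
    and "v \<in> {0..1}"
  shows "hausdorff_dim (uniform_set_exact b a v) = hausdorff_dim (uniform_set b a v)
       \<and> hausdorff_dim (uniform_set b a v) = ereal (((1 - v) / (1 + v))\<^sup>2)"
proof -
  interpret slowly_growing_seq a
    using assms(2-4,6) by unfold_locales auto
  have eq: "uniform_set b a v = uniform_set b (\<lambda>n. n) v"
    "uniform_set_exact b a v = uniform_set_exact b (\<lambda>n. n) v"
    using uniform_exponent_eq_id[of b] assms(1) by (simp_all add: uniform_set_def uniform_set_exact_def)
  have v: "0 \<le> v" "v \<le> 1" using assms(7) by auto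
  have "hausdorff_dim (uniform_set_exact b a v) \<le> hausdorff_dim (uniform_set b a v)"
    by (intro hausdorff_dim_mono) (auto simp: uniform_set_def uniform_set_exact_def)
  moreover have "hausdorff_dim (uniform_set b a v) \<le> ereal (((1 - v) / (1 + v))\<^sup>2)"
    unfolding eq by (rule hausdorff_dim_uniform_set_id_le[OF assms(1) v])
  moreover have "ereal (((1 - v) / (1 + v))\<^sup>2) \<le> hausdorff_dim (uniform_set_exact b a v)"
    unfolding eq by (rule hausdorff_dim_uniform_set_exact_id_ge[OF assms(1) v])
  ultimately show ?thesis by (metis order_antisym order_trans)
qed

end
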